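(* For every $n\ge1$ there exists a Medvedev degree $\mathbf{D}_n$ such that $\mathfrak{B}_n$ is B-embeddable in $\mathfrak{M}/\mathbf{D}_n$.
   Context: A mass problem is a subset of Baire space $\omega^\omega$. $\mathcal{A}\le_M\mathcal{B}$ iff there is a partial Turing functional $\Psi$ such that for every $f\in\mathcal{B}$, $\Psi(f)$ is defined and $\Psi(f)\in\mathcal{A}$; Medvedev degrees are the $\equiv_M$-classes, forming the Brouwer algebra $\mathfrak{M}$ (bounded distributive lattice with $a\rightarrow b=\min\{c:a+c\ge b\}$) under join $\mathcal{A}+\mathcal{B}=\{f\oplus g: f\in\mathcal{A},g\in\mathcal{B}\}$, meet $\mathcal{A}\times\mathcal{B}=\{\langle0\rangle^\frown f:f\in\mathcal{A}\}\cup\{\langle1\rangle^\frown g:g\in\mathcal{B}\}$ and implication $\mathcal{A}\rightarrow\mathcal{B}=\{\langle z\rangle^\frown f:\forall g\in\mathcal{B}\,(\Phi_z(g\oplus f)\in\mathcal{A})\}$. For a Brouwer algebra $\mathfrak{L}$ and $a\in\mathfrak{L}$, $\mathfrak{L}/a$ is the Brouwer algebra on the initial segment $[0,a]$ with the same join, meet and $\rightarrow$, top $a$ and negation $\neg b=b\rightarrow a$. A Brouwer algebra $\mathfrak{L}_1$ is B-embeddable in a Brouwer algebra $\mathfrak{L}_2$ if there is a lattice homomorphism $\mathfrak{L}_1\to\mathfrak{L}_2$ preserving $0$, $1$ and $\rightarrow$. For $n\ge1$, $\mathfrak{B}_n$ is the Brouwer algebra of all subsets $U$ of $\mathcal{P}(\{0,\dots,n-1\})\setminus\{\emptyset\}$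 closed under nonempty subsets, ordered by $\supseteq$ (join $\cap$, meet $\cup$); equivalently, the free distributive lattice on $n$ generators with a new bottom element added. *)

theory Defs
  imports Main
begin

section \<open>Partial recursive functions relative to an oracle\<close>

text \<open>Kleene's mu-recursive schemes with one extra basic function, the oracle.
  The relation \<open>eval f p xs y\<close> says that program \<open>p\<close> with oracle \<open>f\<close> converges on the
  argument tuple \<open>xs\<close> with value \<open>y\<close>; programs applied to tuples of the wrong length diverge.\<close>

datatype recf =
    Zero
  | Succ
  | Proj nat
  | Oracle
  | Comp recf "recf list"
  | Prec recf recf
  | Mu recf

inductive eval :: "(nat \<Rightarrow> nat) \<Rightarrow> recf \<Rightarrow> nat list \<Rightarrow> nat \<Rightarrow> bool" for f :: "nat \<Rightarrow> nat" where
  Zero: "eval f Zero xs 0"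
| Succ: "eval f Succ [x] (Suc x)"
| Proj: "i < length xs \<Longrightarrow> eval f (Proj i) xs (xs ! i)"
| Oracle: "eval f Oracle [x] (f x)"
| Comp: "list_all2 (\<lambda>g y. eval f g xs y) gs ys \<Longrightarrow> eval f h ys z \<Longrightarrow> eval f (Comp h gs) xs z"
| Prec_0: "eval f g xs y \<Longrightarrow> eval f (Prec g h) (0 # xs) y"
| Prec_Suc: "eval f (Prec g h) (n # xs) y \<Longrightarrow> eval f h (n # y # xs) z
    \<Longrightarrow> eval f (Prec g h) (Suc n # xs) z"
| Mu: "eval f g (n # xs) 0 \<Longrightarrow> (\<forall>m<n. \<exists>y. 0 < y \<and> eval f g (m # xs) y) \<Longrightarrow> eval f (Mu g) xs n"

inductive_cases eval_ZeroE: "eval f Zero xs y"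
inductive_cases eval_SuccE: "eval f Succ xs y"
inductive_cases eval_ProjE: "eval f (Proj i) xs y"
inductive_cases eval_OracleE: "eval f Oracle xs y"
inductive_cases eval_CompE: "eval f (Comp h gs) xs y"
inductive_cases eval_Prec0E: "eval f (Prec g h) (0 # xs) y"
inductive_cases eval_PrecSucE: "eval f (Prec g h) (Suc n # xs) y"
inductive_cases eval_MuE: "eval f (Mu g) xs y"

lemma eval_deterministic: "eval f p xs y \<Longrightarrow> eval f p xs z \<Longrightarrow> y = z"
proof (induction arbitrary: z rule: eval.induct)
  case (Comp xs gs ys h z w)
  from Comp.prems obtain ys' where
    "list_all2 (\<lambda>g y. eval f g xs y) gs ys'" "eval f h ys' w"
    by (auto elim: eval_CompE)
  moreover have "ys = ys'"
    using Comp.IH(1) calculation(1) by (auto simp: list_all2_conv_all_nth intro: nth_equalityI)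
  ultimately show ?case using Comp.IH(2) by blast
next
  case (Prec_Suc g h n xs y z)
  from Prec_Suc.prems show ?case
    by (rule eval_PrecSucE) (use Prec_Suc.IH in blast)
next
  case (Mu g n xs)
  from Mu.prems obtain "eval f g (z # xs) 0" "\<forall>m<z. \<exists>y. 0 < y \<and> eval f g (m # xs) y"
    by (auto elim: eval_MuE)
  then show ?case using Mu.IH
    by (metis linorder_neqE_nat less_numeral_extra(3))
next
  case (Zero xs)
  then show ?case by (rule eval_ZeroE) simp
next
  case (Succ x)
  from Succ.prems show ?case by (rule eval_SuccE) simp
next
  case (Proj i xs)
  from Proj.prems show ?case by (rule eval_ProjE) simp
next
  case (Oracle x)
  from Oracle.prems show ?case by (rule eval_OracleE) simp
next
  case (Prec_0 g xs y h)
  from Prec_0.prems show ?case by (rule eval_Prec0E) (rule Prec_0.IH)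
qed

text \<open>The partial Turing functional given by \<open>p\<close> is defined on \<open>f\<close> with value \<open>g\<close>.\<close>

definition computes :: "recf \<Rightarrow> (nat \<Rightarrow> nat) \<Rightarrow> (nat \<Rightarrow> nat) \<Rightarrow> bool" where
  "computes p f g \<longleftrightarrow> (\<forall>x. eval f p [x] (g x))"

section \<open>Mass problems and Medvedev reducibility\<close>

type_synonym mass_problem = "(nat \<Rightarrow> nat) set"

definition medvedev_le :: "mass_problem \<Rightarrow> mass_problem \<Rightarrow> bool" where
  "medvedev_le A B \<longleftrightarrow> (\<exists>p. \<forall>f\<in>B. \<exists>g\<in>A. computes p f g)"

definition medvedev_equiv :: "mass_problem \<Rightarrow> mass_problem \<Rightarrow> bool" where
  "medvedev_equiv A B \<longleftrightarrow> medvedev_le A B \<and> medvedev_le B A"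

definition fun_join :: "(nat \<Rightarrow> nat) \<Rightarrow> (nat \<Rightarrow> nat) \<Rightarrow> nat \<Rightarrow> nat" where
  "fun_join f g x = (if even x then f (x div 2) else g (x div 2))"

definition fun_cons :: "nat \<Rightarrow> (nat \<Rightarrow> nat) \<Rightarrow> nat \<Rightarrow> nat" where
  "fun_cons i f x = (case x of 0 \<Rightarrow> i | Suc y \<Rightarrow> f y)"

definition mass_join :: "mass_problem \<Rightarrow> mass_problem \<Rightarrow> mass_problem" where
  "mass_join A B = {fun_join f g | f g. f \<in> A \<and> g \<in> B}"

definition mass_meet :: "mass_problem \<Rightarrow> mass_problem \<Rightarrow> mass_problem" where
  "mass_meet A B = fun_cons 0 ` A \<union> fun_cons 1 ` B"

subsection \<open>Programs\<close>

lemma eval_Proj': "i < length xs \<Longrightarrow> y = xs ! i \<Longrightarrow> eval f (Proj i) xs y"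
  by (simp add: eval.Proj)

lemma eval_Comp1: "eval f g xs y \<Longrightarrow> eval f h [y] z \<Longrightarrow> eval f (Comp h [g]) xs z"
  by (rule eval.Comp[where ys = "[y]"]) auto

lemma eval_Comp3: "eval f g1 xs y1 \<Longrightarrow> eval f g2 xs y2 \<Longrightarrow> eval f g3 xs y3
    \<Longrightarrow> eval f h [y1, y2, y3] z \<Longrightarrow> eval f (Comp h [g1, g2, g3]) xs z"
  by (rule eval.Comp[where ys = "[y1, y2, y3]"]) auto

lemma eval_Comp_Succ: "eval f g xs y \<Longrightarrow> z = Suc y \<Longrightarrow> eval f (Comp Succ [g]) xs z"
  using eval_Comp1 eval.Succ by blast

lemma eval_Comp_Oracle: "eval f g xs y \<Longrightarrow> z = f y \<Longrightarrow> eval f (Comp Oracle [g]) xs z"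
  using eval_Comp1 eval.Oracle by blast

definition Sel :: recf where "Sel = Prec (Proj 0) (Proj 3)"

lemma eval_Sel: "eval f Sel [c, a, b] (if c = 0 then a else b)"
proof (induction c)
  case 0
  then show ?case
    unfolding Sel_def by (auto intro!: eval.Prec_0 eval_Proj')
next
  case (Suc c)
  then show ?case
    unfolding Sel_def by (auto intro!: eval.Prec_Suc eval_Proj')
qed

definition Cond :: "recf \<Rightarrow> recf \<Rightarrow> recf \<Rightarrow> recf" where
  "Cond c p q = Comp Sel [c, p, q]"

lemma eval_Cond:
  assumes "eval f c xs k" "eval f p xs a" "eval f q xs b" "y = (if k = 0 then a else b)"
  shows "eval f (Cond c p q) xs y"
  unfolding Cond_def assms(4) using assms(1-3) eval_Sel by (rule eval_Comp3)

definition Numeral :: "nat \<Rightarrow> recf" where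
  "Numeral k = ((\<lambda>p. Comp Succ [p]) ^^ k) Zero"

lemma eval_Numeral: "eval f (Numeral k) xs k"
  by (induction k) (auto simp: Numeral_def intro: eval.Zero eval_Comp_Succ)

definition Parity :: recf where
  "Parity = Prec Zero (Cond (Proj 1) (Numeral 1) Zero)"

lemma eval_Parity: "eval f Parity [x] (x mod 2)"
proof (induction x)
  case 0
  show ?case unfolding Parity_def by (auto intro!: eval.Prec_0 eval.Zero)
next
  case (Suc x)
  show ?case unfolding Parity_def
    by (rule eval.Prec_Suc[OF Suc[unfolded Parity_def]],
        rule eval_Cond[OF eval_Proj'[OF _ refl] eval_Numeral eval.Zero])
      (auto simp: mod_Suc)
qed

definition Half :: recf where
  "Half = Prec Zero (Cond (Comp Parity [Proj 0]) (Proj 1) (Comp Succ [Proj 1]))"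

lemma eval_Half: "eval f Half [x] (x div 2)"
proof (induction x)
  case 0
  show ?case unfolding Half_def by (auto intro!: eval.Prec_0 eval.Zero)
next
  case (Suc x)
  show ?case unfolding Half_def
    by (rule eval.Prec_Suc[OF Suc[unfolded Half_def]],
        rule eval_Cond[OF eval_Comp1[OF eval_Proj'[OF _ refl] eval_Parity]
          eval_Proj'[OF _ refl] eval_Comp_Succ[OF eval_Proj'[OF _ refl] refl]])
      (simp_all, presburger)
qed

definition Double :: recf where
  "Double = Prec Zero (Comp Succ [Comp Succ [Proj 1]])"

lemma eval_Double: "eval f Double [x] (2 * x)"
proof (induction x)
  case 0
  show ?case unfolding Double_def by (auto intro!: eval.Prec_0 eval.Zero)
next
  case (Suc x)
  show ?case unfolding Double_def
    by (rule eval.Prec_Suc[OF Suc[unfolded Double_def]],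
        rule eval_Comp_Succ[OF eval_Comp_Succ[OF eval_Proj'[OF _ refl] refl]])
      auto
qed

text \<open>Replacing the oracle by a program.\<close>

fun subst :: "recf \<Rightarrow> recf \<Rightarrow> recf" where
  "subst q Oracle = q"
| "subst q (Comp h gs) = Comp (subst q h) (map (subst q) gs)"
| "subst q (Prec g h) = Prec (subst q g) (subst q h)"
| "subst q (Mu g) = Mu (subst q g)"
| "subst q p = p"

lemma eval_subst:
  assumes "computes q h f" "eval f p xs y"
  shows "eval h (subst q p) xs y"
  using assms(2)
proof (induction rule: eval.induct)
  case (Comp xs gs ys p z)
  have "list_all2 (\<lambda>g y. eval h g xs y) (map (subst q) gs) ys"
    using Comp.IH(1) by (simp add: list_all2_conv_all_nth)
  then show ?case using Comp.IH(2) by (auto intro: eval.Comp)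
next
  case (Mu g n xs)
  then show ?case by (auto intro!: eval.Mu)
next
  case (Prec_Suc g p n xs y z)
  then show ?case by (simp add: eval.Prec_Suc)
qed (use assms(1) in \<open>simp_all add: computes_def eval.Zero eval.Succ eval.Proj eval.Prec_0\<close>)

lemma computes_subst: "computes q h f \<Longrightarrow> computes p f g \<Longrightarrow> computes (subst q p) h g"
  by (simp add: computes_def eval_subst)

text \<open>Adding a flag as last argument: if the flag is \<open>0\<close> then \<open>guard n p\<close> behaves like \<open>p\<close>
  on tuples of length \<open>n\<close>, otherwise it converges. This yields definition by cases with
  partial branches.\<close>

fun guard :: "nat \<Rightarrow> recf \<Rightarrow> recf" where
  "guard n Zero = Zero"
| "guard n Succ = (if n = 1 then Comp Succ [Proj 0] else Zero)"
| "guard n (Proj i) = (if i < n then Proj i else Zero)"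
| "guard n Oracle = (if n = 1 then Comp Oracle [Proj 0] else Zero)"
| "guard n (Comp h gs) = Comp (guard (length gs) h) (map (guard n) gs @ [Proj n])"
| "guard n (Prec g h) =
    (case n of 0 \<Rightarrow> Zero | Suc m \<Rightarrow> Prec (guard m g) (guard (Suc n) h))"
| "guard n (Mu g) = Mu (Cond (Proj (Suc n)) (guard (Suc n) g) Zero)"

lemma eval_guard:
  "eval f p xs y \<Longrightarrow> eval f (guard (length xs) p) (xs @ [0]) y"
proof (induction rule: eval.induct)
  case (Proj i xs)
  then show ?case by (auto intro!: eval_Proj' simp: nth_append)
next
  case (Comp xs gs ys h z)
  have len: "length gs = length ys" using Comp.IH(1) by (rule list_all2_lengthD)
  have "list_all2 (\<lambda>g y. eval f g (xs @ [0]) y) (map (guard (length xs)) gs @ [Proj (length xs)])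
      (ys @ [0])"
    by (rule list_all2_appendI)
      (use Comp.IH(1) in \<open>auto simp: list_all2_conv_all_nth intro!: eval_Proj'\<close>)
  then show ?case using Comp.IH(2) len by (auto intro: eval.Comp)
next
  case (Mu g n xs)
  have *: "eval f (Cond (Proj (Suc (length xs))) (guard (Suc (length xs)) g) Zero)
      (m # xs @ [0]) y" if "eval f (guard (length (m # xs)) g) ((m # xs) @ [0]) y" for m y
    by (rule eval_Cond[where k = 0 and a = y and b = 0])
      (use that in \<open>auto intro: eval.Zero eval_Proj'\<close>)
  have "eval f (Mu (Cond (Proj (Suc (length xs))) (guard (Suc (length xs)) g) Zero)) (xs @ [0]) n"
  proof (rule eval.Mu)
    show "eval f (Cond (Proj (Suc (length xs))) (guard (Suc (length xs)) g) Zero) (n # xs @ [0]) 0"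
      using * Mu.IH(1) by blast
    show "\<forall>m<n. \<exists>y. 0 < y \<and>
        eval f (Cond (Proj (Suc (length xs))) (guard (Suc (length xs)) g) Zero) (m # xs @ [0]) y"
      using * Mu.IH(2) by blast
  qed
  then show ?case by simp
next
  case (Prec_0 g xs y h)
  then show ?case by (simp add: eval.Prec_0)
next
  case (Prec_Suc g h n xs y z)
  then show ?case by (simp add: eval.Prec_Suc)
qed (auto intro: eval.Zero eval_Comp_Succ eval_Comp_Oracle eval_Proj')

lemma eval_guard_total:
  assumes "0 < c"
  shows "length xs = n \<Longrightarrow> \<exists>y. eval f (guard n p) (xs @ [c]) y"
proof (induction p arbitrary: n xs)
  case (Comp h gs)
  have "\<forall>g\<in>set gs. \<exists>y. eval f (guard n g) (xs @ [c]) y"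
    using Comp.IH(2) Comp.prems by blast
  then obtain F where F: "\<And>g. g \<in> set gs \<Longrightarrow> eval f (guard n g) (xs @ [c]) (F g)"
    by metis
  obtain z where z: "eval f (guard (length gs) h) (map F gs @ [c]) z"
    using Comp.IH(1)[of "map F gs" "length gs"] by auto
  have "list_all2 (\<lambda>g y. eval f g (xs @ [c]) y) (map (guard n) gs @ [Proj n]) (map F gs @ [c])"
    by (rule list_all2_appendI)
      (use F Comp.prems in \<open>auto simp: list_all2_conv_all_nth intro!: eval_Proj'\<close>)
  with z show ?case by (auto intro: eval.Comp)
next
  case (Prec g h)
  show ?case
  proof (cases xs)
    case Nil
    then show ?thesis using Prec.prems by (auto intro: eval.Zero)
  next
    case (Cons k ys)
    have "\<exists>y. eval f (Prec (guard (length ys) g) (guard (Suc n) h)) (k # ys @ [c]) y"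
    proof (induction k)
      case 0
      then show ?case using Prec.IH(1)[of ys] by (auto intro: eval.Prec_0)
    next
      case (Suc k)
      then obtain y where
        "eval f (Prec (guard (length ys) g) (guard (Suc n) h)) (k # ys @ [c]) y" by blast
      moreover obtain z where "eval f (guard (Suc n) h) (k # y # ys @ [c]) z"
        using Prec.IH(2)[of "k # y # ys" "Suc n"] Prec.prems Cons by auto
      ultimately show ?case by (auto intro: eval.Prec_Suc)
    qed
    then show ?thesis using Cons Prec.prems by auto
  qed
next
  case (Mu g)
  obtain y where "eval f (guard (Suc n) g) (0 # xs @ [c]) y"
    using Mu.IH[of "0 # xs"] Mu.prems by auto
  then have "eval f (Cond (Proj (Suc n)) (guard (Suc n) g) Zero) (0 # xs @ [c]) 0"
    using assms Mu.prems
    by (intro eval_Cond[where k = c and a = y and b = 0])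
      (auto intro: eval.Zero eval_Proj' simp: nth_append)
  then have "eval f (Mu (Cond (Proj (Suc n)) (guard (Suc n) g) Zero)) (xs @ [c]) 0"
    by (rule eval.Mu) simp
  then show ?case by auto
next
  case Zero
  then show ?case by (auto intro: eval.Zero)
next
  case Succ
  then show ?case
    by (cases xs) (auto intro: eval.Zero eval_Comp_Succ eval_Proj')
next
  case (Proj i)
  then show ?case
    using eval.Zero eval.Proj[of i "xs @ [c]" f] by (cases "i < n") auto
next
  case Oracle
  then show ?case
    by (cases xs) (auto intro: eval.Zero eval_Comp_Oracle eval_Proj')
qed

subsection \<open>The order and its bounds\<close>

lemma medvedev_leI: "(\<And>f. f \<in> B \<Longrightarrow> \<exists>g\<in>A. computes p f g) \<Longrightarrow> medvedev_le A B"
  unfolding medvedev_le_def by blast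

lemma medvedev_le_refl: "medvedev_le A A"
  by (rule medvedev_leI[where p = Oracle]) (auto simp: computes_def intro: eval.Oracle)

lemma medvedev_le_trans: "medvedev_le A B \<Longrightarrow> medvedev_le B C \<Longrightarrow> medvedev_le A C"
  unfolding medvedev_le_def by (meson computes_subst)

lemma mass_join_upper1: "medvedev_le A (mass_join A B)"
proof (rule medvedev_leI[where p = "Comp Oracle [Double]"])
  fix h assume "h \<in> mass_join A B"
  then obtain f g where "f \<in> A" "h = fun_join f g" by (auto simp: mass_join_def)
  then show "\<exists>g\<in>A. computes (Comp Oracle [Double]) h g"
    by (auto simp: computes_def fun_join_def intro!: bexI[of _ f] eval_Comp_Oracle[OF eval_Double])
qed

lemma mass_join_upper2: "medvedev_le B (mass_join A B)"
proof (rule medvedev_leI[where p = "Comp Oracle [Comp Succ [Double]]"])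
  fix h assume "h \<in> mass_join A B"
  then obtain f g where "g \<in> B" "h = fun_join f g" by (auto simp: mass_join_def)
  then show "\<exists>g\<in>B. computes (Comp Oracle [Comp Succ [Double]]) h g"
    by (auto simp: computes_def fun_join_def
        intro!: bexI[of _ g] eval_Comp_Oracle[OF eval_Comp_Succ[OF eval_Double]])
qed

lemma mass_join_least:
  assumes "medvedev_le A C" "medvedev_le B C"
  shows "medvedev_le (mass_join A B) C"
proof -
  from assms obtain p q where
    p: "\<And>h. h \<in> C \<Longrightarrow> \<exists>f\<in>A. computes p h f" and q: "\<And>h. h \<in> C \<Longrightarrow> \<exists>g\<in>B. computes q h g"
    unfolding medvedev_le_def by meson
  show ?thesis
  proof (rule medvedev_leI[where p = "Cond Parity (Comp p [Half]) (Comp q [Half])"])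
    fix h assume "h \<in> C"
    then obtain f g where "f \<in> A" "computes p h f" "g \<in> B" "computes q h g"
      using p q by blast
    then show "\<exists>k\<in>mass_join A B. computes (Cond Parity (Comp p [Half]) (Comp q [Half])) h k"
      unfolding computes_def
      by (intro bexI[of _ "fun_join f g"] allI
          eval_Cond[OF eval_Parity eval_Comp1[OF eval_Half] eval_Comp1[OF eval_Half]])
        (auto simp: mass_join_def fun_join_def even_iff_mod_2_eq_zero)
  qed
qed

definition Prepend :: "nat \<Rightarrow> recf" where
  "Prepend i = Prec (Numeral i) (Comp Oracle [Proj 0])"

lemma computes_Prepend: "computes (Prepend i) f (fun_cons i f)"
  unfolding computes_def
proof
  fix x
  show "eval f (Prepend i) [x] (fun_cons i f x)"
  proof (induction x)
    case 0
    show ?case by (auto simp: Prepend_def fun_cons_def intro: eval.Prec_0 eval_Numeral)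
  next
    case (Suc x)
    then show ?case unfolding Prepend_def
      by (rule eval.Prec_Suc) (auto simp: fun_cons_def intro!: eval_Comp_Oracle eval_Proj')
  qed
qed

lemma mass_meet_lower1: "medvedev_le (mass_meet A B) A"
  by (rule medvedev_leI[where p = "Prepend 0"])
    (use computes_Prepend in \<open>auto simp: mass_meet_def\<close>)

lemma mass_meet_lower2: "medvedev_le (mass_meet A B) B"
  by (rule medvedev_leI[where p = "Prepend 1"])
    (use computes_Prepend in \<open>auto simp: mass_meet_def\<close>)

definition Tail :: recf where "Tail = Comp Oracle [Succ]"

lemma computes_Tail: "computes Tail (fun_cons i f) f"
  by (auto simp: computes_def Tail_def fun_cons_def intro!: eval_Comp_Oracle[OF eval.Succ])

lemma mass_meet_greatest:
  assumes "medvedev_le C A" "medvedev_le C B"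
  shows "medvedev_le C (mass_meet A B)"
proof -
  from assms obtain p q where
    p: "\<And>f. f \<in> A \<Longrightarrow> \<exists>k\<in>C. computes p f k" and q: "\<And>g. g \<in> B \<Longrightarrow> \<exists>k\<in>C. computes q g k"
    unfolding medvedev_le_def by meson
  define flag where "flag = Comp Oracle [Zero]"
  define coflag where "coflag = Cond flag (Numeral 1) Zero"
  define r where "r = Cond flag
    (Comp (guard 1 (subst Tail p)) [Proj 0, flag])
    (Comp (guard 1 (subst Tail q)) [Proj 0, coflag])"
  have flag: "eval (fun_cons i f) flag xs i" for i f xs
    by (auto simp: flag_def fun_cons_def intro!: eval_Comp_Oracle[OF eval.Zero])
  have coflag: "eval (fun_cons i f) coflag xs (if i = 0 then 1 else 0)" for i f xs
    unfolding coflag_def by (rule eval_Cond[OF flag eval_Numeral eval.Zero refl])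
  have comp2: "eval f (Comp h [Proj 0, g]) [x] z" if "eval f g [x] c" "eval f h [x, c] z"
    for f h g x c z
    using that by (intro eval.Comp[where ys = "[x, c]"]) (auto intro: eval_Proj')
  have sim: "eval (fun_cons i f) (guard 1 (subst Tail s)) [x, 0] (k x)"
    if "computes s f k" for i f s k x
    using eval_guard[OF computes_subst[OF computes_Tail that, unfolded computes_def, rule_format]]
    by simp
  have tot: "\<exists>y. eval f (guard 1 s) [x, Suc 0] y" for f s x
    using eval_guard_total[of 1 "[x]" 1 f s] by simp
  show ?thesis
  proof (rule medvedev_leI[where p = r])
    fix h assume "h \<in> mass_meet A B"
    then consider f where "f \<in> A" "h = fun_cons 0 f" | g where "g \<in> B" "h = fun_cons 1 g"
      by (auto simp: mass_meet_def)
    then show "\<exists>k\<in>C. computes r h k"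
    proof cases
      case 1
      from p[OF 1(1)] obtain k where k: "k \<in> C" "computes p f k" by blast
      have "eval h r [x] (k x)" for x
      proof -
        obtain y where y: "eval h (guard 1 (subst Tail q)) [x, Suc 0] y" using tot by blast
        show ?thesis
          unfolding r_def
          by (rule eval_Cond[where k = 0 and a = "k x" and b = y])
            (use 1 flag coflag[of 0 f] sim[OF k(2)] y
              in \<open>auto intro: comp2[where c = 0] comp2[where c = "Suc 0"]\<close>)
      qed
      with k show ?thesis by (auto simp: computes_def)
    next
      case 2
      from q[OF 2(1)] obtain k where k: "k \<in> C" "computes q g k" by blast
      have "eval h r [x] (k x)" for x
      proof -
        obtain y where y: "eval h (guard 1 (subst Tail p)) [x, Suc 0] y" using tot by blast
        show ?thesis
          unfolding r_def
          by (rule eval_Cond[where k = 1 and a = y and b = "k x"])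
            (use 2 flag[of 1 g] coflag[of 1 g] sim[OF k(2)] y
              in \<open>auto intro: comp2[where c = 0] comp2[where c = "Suc 0"]\<close>)
      qed
      with k show ?thesis by (auto simp: computes_def)
    qed
  qed
qed

lemma mass_join_meet_distrib:
  "medvedev_le (mass_meet (mass_join A B) (mass_join A C)) (mass_join A (mass_meet B C))"
proof -
  define r where "r = Prec (Comp Oracle [Numeral 1])
    (Cond (Comp Parity [Proj 0]) (Comp Oracle [Proj 0])
      (Comp Oracle [Comp Succ [Comp Succ [Proj 0]]]))"
  have r: "computes r (fun_join f (fun_cons i g)) (fun_cons i (fun_join f g))" for f g i
    unfolding computes_def
  proof
    let ?h = "fun_join f (fun_cons i g)"
    fix x
    show "eval ?h r [x] (fun_cons i (fun_join f g) x)"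
    proof (induction x)
      case 0
      show ?case unfolding r_def
        by (rule eval.Prec_0, rule eval_Comp_Oracle[OF eval_Numeral])
          (auto simp: fun_cons_def fun_join_def)
    next
      case (Suc x)
      show ?case unfolding r_def
        by (rule eval.Prec_Suc[OF Suc[unfolded r_def]],
            rule eval_Cond[OF eval_Comp1[OF eval_Proj'[OF _ refl] eval_Parity]
              eval_Comp_Oracle[OF eval_Proj'[OF _ refl] refl]
              eval_Comp_Oracle[OF eval_Comp_Succ[OF eval_Comp_Succ[OF eval_Proj'[OF _ refl] refl] refl]
                refl]])
          (auto simp: fun_cons_def fun_join_def even_iff_mod_2_eq_zero)
    qed
  qed
  show ?thesis
  proof (rule medvedev_leI[where p = r])
    fix h assume "h \<in> mass_join A (mass_meet B C)"
    then obtain f g i where "h = fun_join f (fun_cons i g)" "f \<in> A"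
      "i = 0 \<and> g \<in> B \<or> i = 1 \<and> g \<in> C"
      by (auto simp: mass_join_def mass_meet_def)
    then show "\<exists>k\<in>mass_meet (mass_join A B) (mass_join A C). computes r h k"
      using r[of f i g]
      by (intro bexI[of _ "fun_cons i (fun_join f g)"]) (fastforce simp: mass_join_def mass_meet_def)+
  qed
qed

section \<open>The Medvedev lattice\<close>

quotient_type medvedev = mass_problem / medvedev_equiv
proof (rule equivpI)
  show "reflp medvedev_equiv"
    by (simp add: reflp_def medvedev_equiv_def medvedev_le_refl)
  show "symp medvedev_equiv"
    by (simp add: symp_def medvedev_equiv_def)
  show "transp medvedev_equiv"
    unfolding transp_def medvedev_equiv_def by (meson medvedev_le_trans)
qed

instantiation medvedev :: "{distrib_lattice, bounded_lattice}"
begin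

lift_definition less_eq_medvedev :: "medvedev \<Rightarrow> medvedev \<Rightarrow> bool" is medvedev_le
  unfolding medvedev_equiv_def by (meson medvedev_le_trans)

definition less_medvedev :: "medvedev \<Rightarrow> medvedev \<Rightarrow> bool" where
  "less_medvedev a b \<longleftrightarrow> a \<le> b \<and> \<not> b \<le> a"

lift_definition sup_medvedev :: "medvedev \<Rightarrow> medvedev \<Rightarrow> medvedev" is mass_join
  unfolding medvedev_equiv_def
  by (meson mass_join_least mass_join_upper1 mass_join_upper2 medvedev_le_trans)

lift_definition inf_medvedev :: "medvedev \<Rightarrow> medvedev \<Rightarrow> medvedev" is mass_meet
  unfolding medvedev_equiv_def
  by (meson mass_meet_greatest mass_meet_lower1 mass_meet_lower2 medvedev_le_trans)

lift_definition bot_medvedev :: medvedev is UNIV .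

lift_definition top_medvedev :: medvedev is "{}" .

instance
proof
  fix x y z :: medvedev
  show "(x < y) = (x \<le> y \<and> \<not> y \<le> x)" by (fact less_medvedev_def)
  show "x \<le> x" by transfer (rule medvedev_le_refl)
  show "x \<le> y \<Longrightarrow> y \<le> z \<Longrightarrow> x \<le> z" by transfer (rule medvedev_le_trans)
  show "x \<le> y \<Longrightarrow> y \<le> x \<Longrightarrow> x = y" by transfer (simp add: medvedev_equiv_def)
  show "inf x y \<le> x" by transfer (rule mass_meet_lower1)
  show "inf x y \<le> y" by transfer (rule mass_meet_lower2)
  show "x \<le> y \<Longrightarrow> x \<le> z \<Longrightarrow> x \<le> inf y z" by transfer (rule mass_meet_greatest)
  show "x \<le> sup x y" by transfer (rule mass_join_upper1)
  show "y \<le> sup x y" by transfer (rule mass_join_upper2)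
  show "y \<le> x \<Longrightarrow> z \<le> x \<Longrightarrow> sup y z \<le> x" by transfer (rule mass_join_least)
  show "sup x (inf y z) = inf (sup x y) (sup x z)"
  proof transfer
    fix A B C
    have "medvedev_le (mass_join A (mass_meet B C)) (mass_meet (mass_join A B) (mass_join A C))"
      by (intro mass_join_least mass_meet_greatest mass_join_upper1)
        (meson mass_meet_lower1 mass_meet_lower2 mass_join_upper2 medvedev_le_trans)+
    then show "medvedev_equiv (mass_join A (mass_meet B C))
        (mass_meet (mass_join A B) (mass_join A C))"
      using mass_join_meet_distrib by (simp add: medvedev_equiv_def)
  qed
  show "bot \<le> x"
  proof transfer
    fix A
    have "computes Oracle f f" for f
      by (auto simp: computes_def intro: eval.Oracle)
    then show "medvedev_le UNIV A"
      by (blast intro: medvedev_leI)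
  qed
  show "x \<le> top" by transfer (auto intro: medvedev_leI)
qed

end

section \<open>Brouwer algebras and B-embeddings\<close>

text \<open>The signature of a Brouwer algebra on a carrier set. In both algebras below \<open>imp a b\<close> is
  the co-Heyting implication, the minimum of all \<open>c\<close> with \<open>b \<le> join a c\<close>. It always
  exists; for the Medvedev lattice it is the degree of the mass problem of all \<open>z\<close> followed
  by \<open>f\<close> such that the functional with index \<open>z\<close> maps the join of \<open>g\<close> and \<open>f\<close> into \<open>B\<close>,
  for every \<open>g \<in> A\<close>.\<close>

record 'a brouwer =
  carrier :: "'a set"
  le :: "'a \<Rightarrow> 'a \<Rightarrow> bool"
  join :: "'a \<Rightarrow> 'a \<Rightarrow> 'a"
  meet :: "'a \<Rightarrow> 'a \<Rightarrow> 'a"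
  zero :: 'a
  one :: 'a
  imp :: "'a \<Rightarrow> 'a \<Rightarrow> 'a"

definition is_min_imp ::
  "'a set \<Rightarrow> ('a \<Rightarrow> 'a \<Rightarrow> bool) \<Rightarrow> ('a \<Rightarrow> 'a \<Rightarrow> 'a) \<Rightarrow> 'a \<Rightarrow> 'a \<Rightarrow> 'a \<Rightarrow> bool" where
  "is_min_imp C leq j a b c \<longleftrightarrow>
    c \<in> C \<and> leq b (j a c) \<and> (\<forall>d\<in>C. leq b (j a d) \<longrightarrow> leq c d)"

definition min_imp ::
  "'a set \<Rightarrow> ('a \<Rightarrow> 'a \<Rightarrow> bool) \<Rightarrow> ('a \<Rightarrow> 'a \<Rightarrow> 'a) \<Rightarrow> 'a \<Rightarrow> 'a \<Rightarrow> 'a" where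
  "min_imp C leq j a b = (THE c. is_min_imp C leq j a b c)"

definition factor :: "'a brouwer \<Rightarrow> 'a \<Rightarrow> 'a brouwer" where
  "factor L a = L\<lparr>carrier := {b \<in> carrier L. le L b a}, one := a\<rparr>"

text \<open>An embedding is understood to be injective.\<close>

definition B_embedding :: "('a \<Rightarrow> 'b) \<Rightarrow> 'a brouwer \<Rightarrow> 'b brouwer \<Rightarrow> bool" where
  "B_embedding \<phi> L1 L2 \<longleftrightarrow>
    \<phi> ` carrier L1 \<subseteq> carrier L2 \<and> inj_on \<phi> (carrier L1) \<and>
    \<phi> (zero L1) = zero L2 \<and> \<phi> (one L1) = one L2 \<and>
    (\<forall>a\<in>carrier L1. \<forall>b\<in>carrier L1.
      \<phi> (join L1 a b) = join L2 (\<phi> a) (\<phi> b) \<and>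
      \<phi> (meet L1 a b) = meet L2 (\<phi> a) (\<phi> b) \<and>
      \<phi> (imp L1 a b) = imp L2 (\<phi> a) (\<phi> b))"

definition B_embeddable :: "'a brouwer \<Rightarrow> 'b brouwer \<Rightarrow> bool" where
  "B_embeddable L1 L2 \<longleftrightarrow> (\<exists>\<phi>. B_embedding \<phi> L1 L2)"

definition medvedev_algebra :: "medvedev brouwer" where
  "medvedev_algebra = \<lparr>carrier = UNIV, le = (\<le>), join = sup, meet = inf, zero = bot, one = top,
    imp = min_imp UNIV (\<le>) sup\<rparr>"

definition B_carrier :: "nat \<Rightarrow> nat set set set" where
  "B_carrier n = {U. U \<subseteq> Pow {..<n} - {{}} \<and> (\<forall>x\<in>U. \<forall>y. y \<subseteq> x \<and> y \<noteq> {} \<longrightarrow> y \<in> U)}"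

text \<open>The order is reverse inclusion, so \<open>{}\<close> is the top element.\<close>

definition B_algebra :: "nat \<Rightarrow> nat set set brouwer" where
  "B_algebra n = \<lparr>carrier = B_carrier n, le = (\<supseteq>), join = (\<inter>), meet = (\<union>),
    zero = Pow {..<n} - {{}}, one = {}, imp = min_imp (B_carrier n) (\<supseteq>) (\<inter>)\<rparr>"

lemma min_imp_eqI:
  assumes "is_min_imp C leq j a b c" "\<And>x y. x \<in> C \<Longrightarrow> y \<in> C \<Longrightarrow> leq x y \<Longrightarrow> leq y x \<Longrightarrow> x = y"
  shows "min_imp C leq j a b = c"
  unfolding min_imp_def
  by (rule the_equality) (use assms in \<open>auto simp: is_min_imp_def\<close>)

lemma is_min_imp_B_algebra:
  assumes "U \<in> B_carrier n" "V \<in> B_carrier n"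
  shows "is_min_imp (B_carrier n) (\<supseteq>) (\<inter>) U V
    {x \<in> Pow {..<n} - {{}}. \<forall>y. y \<subseteq> x \<and> y \<noteq> {} \<and> y \<in> U \<longrightarrow> y \<in> V}"
proof -
  let ?W = "{x \<in> Pow {..<n} - {{}}. \<forall>y. y \<subseteq> x \<and> y \<noteq> {} \<and> y \<in> U \<longrightarrow> y \<in> V}"
  have "?W \<in> B_carrier n"
    unfolding B_carrier_def
  proof (rule CollectI, intro conjI ballI allI impI)
    fix x y assume x: "x \<in> ?W" and y: "y \<subseteq> x \<and> y \<noteq> {}"
    then have "y \<in> Pow {..<n} - {{}}" by auto
    moreover have "z \<in> V" if "z \<subseteq> y" "z \<noteq> {}" "z \<in> U" for z
      using x y that by (simp add: subset_trans[of z y x])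
    ultimately show "y \<in> ?W" by simp
  qed (rule Collect_restrict)
  moreover have "U \<inter> ?W \<subseteq> V"
    using assms(1) by (auto simp: B_carrier_def)
  moreover have "W \<subseteq> ?W" if "W \<in> B_carrier n" "U \<inter> W \<subseteq> V" for W
    using that by (auto simp: B_carrier_def)
  ultimately show ?thesis
    by (simp add: is_min_imp_def)
qed

lemma imp_B_algebra:
  assumes "U \<in> B_carrier n" "V \<in> B_carrier n"
  shows "imp (B_algebra n) U V =
    {x \<in> Pow {..<n} - {{}}. \<forall>y. y \<subseteq> x \<and> y \<noteq> {} \<and> y \<in> U \<longrightarrow> y \<in> V}"
  using min_imp_eqI[OF is_min_imp_B_algebra[OF assms]] by (simp add: B_algebra_def)

end

theory Submission
  imports Defs "HOL-Library.Countable"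
begin

text \<open>Take an infinite Turing antichain of 0/1-valued functions \<open>x i\<close>. For a set \<open>E\<close> of indices
  let \<open>avoid E\<close> be the mass problem of all functions computable from no \<open>x i\<close> with \<open>i \<in> E\<close>.
  Lower cones are ideals, so the join of \<open>avoid E\<close> and \<open>avoid E'\<close> is \<open>avoid (E \<union> E')\<close>; a set
  system \<open>U\<close> is mapped to the meet of the problems \<open>avoid ({..<n} - I)\<close> for \<open>I \<in> U \<union> {{}}\<close>.

  Implication is preserved because \<open>avoid E \<rightarrow> (avoid E\<^sub>0 \<times> avoid E\<^sub>1 \<times> \<dots>)\<close> equals
  \<open>avoid (E\<^sub>0 - E) \<times> avoid (E\<^sub>1 - E) \<times> \<dots>\<close>. Indeed, let a functional map \<open>f \<oplus> h\<close> to an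
  element of the meet for every \<open>f \<in> avoid E\<close>. Given \<open>h\<close> alone, search for a finite initial segment
  of some \<open>f\<close> on which the functional selects a component \<open>k\<close>. If \<open>i \<in> E\<^sub>k - E\<close> and \<open>h\<close> were
  computable from \<open>x i\<close>, then continuing the segment by \<open>x i \<in> avoid E\<close> would make the functional
  produce an element of \<open>avoid E\<^sub>k\<close> below \<open>x i\<close>. So \<open>h\<close> itself belongs to
  \<open>avoid (E\<^sub>k - E)\<close>.\<close>

section \<open>Bounded simulation\<close>

text \<open>A total approximation of \<^const>\<open>eval\<close> in which unbounded searches stop at \<open>b\<close>: the result is
  \<open>0\<close> for failure and \<open>Suc y\<close> for convergence with value \<open>y\<close>. The state of a search is \<open>0\<close> while
  nothing is found, \<open>1\<close> once the body has failed, and \<open>m + 2\<close> after the zero \<open>m\<close> is found.\<close>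

fun bounded_eval :: "(nat \<Rightarrow> nat) \<Rightarrow> nat \<Rightarrow> recf \<Rightarrow> nat list \<Rightarrow> nat" where
  "bounded_eval f b Zero xs = 1"
| "bounded_eval f b Succ xs = (if length xs = 1 then Suc (Suc (xs ! 0)) else 0)"
| "bounded_eval f b (Proj i) xs = (if i < length xs then Suc (xs ! i) else 0)"
| "bounded_eval f b Oracle xs = (if length xs = 1 then Suc (f (xs ! 0)) else 0)"
| "bounded_eval f b (Comp h gs) xs =
    (if 0 \<in> set (map (\<lambda>g. bounded_eval f b g xs) gs) then 0
     else bounded_eval f b h (map (\<lambda>g. bounded_eval f b g xs - 1) gs))"
| "bounded_eval f b (Prec g h) xs =
    (case xs of [] \<Rightarrow> 0
     | n # ys \<Rightarrow> rec_nat (bounded_eval f b g ys)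
        (\<lambda>m r. if r = 0 then 0 else bounded_eval f b h (m # (r - 1) # ys)) n)"
| "bounded_eval f b (Mu g) xs =
    rec_nat 0 (\<lambda>m r. if r = 0
        then (if bounded_eval f b g (m # xs) = 0 then 1
              else if bounded_eval f b g (m # xs) - 1 = 0 then Suc (Suc m) else 0)
        else r) b - 1"

lemma bounded_eval_sound: "bounded_eval f b p xs = Suc y \<Longrightarrow> eval f p xs y"
proof (induction p arbitrary: xs y)
  case Zero
  then show ?case by (auto intro: eval.Zero)
next
  case Succ
  then show ?case by (cases xs) (auto intro: eval.Succ split: if_splits)
next
  case (Proj i)
  then show ?case by (auto intro: eval_Proj' split: if_splits)
next
  case Oracle
  then show ?case by (cases xs) (auto intro: eval.Oracle split: if_splits)
next
  case (Comp h gs)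
  let ?ys = "map (\<lambda>g. bounded_eval f b g xs - 1) gs"
  from Comp.prems have nz: "\<forall>g\<in>set gs. bounded_eval f b g xs \<noteq> 0"
    and h: "bounded_eval f b h ?ys = Suc y"
    by (auto split: if_splits)
  have "eval f g xs (bounded_eval f b g xs - 1)" if "g \<in> set gs" for g
    by (rule Comp.IH(2)[OF that]) (use nz that in simp)
  then have "list_all2 (\<lambda>g y. eval f g xs y) gs ?ys"
    by (simp add: list_all2_conv_all_nth)
  then show ?case using Comp.IH(1)[OF h] by (rule eval.Comp)
next
  case (Prec g h)
  then obtain n ys where xs: "xs = n # ys" by (cases xs) auto
  let ?r = "rec_nat (bounded_eval f b g ys)
        (\<lambda>m r. if r = 0 then 0 else bounded_eval f b h (m # (r - 1) # ys))"
  have "?r n = Suc y \<Longrightarrow> eval f (Prec g h) (n # ys) y"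
  proof (induction n arbitrary: y)
    case 0
    then show ?case using Prec.IH(1) by (auto intro: eval.Prec_0)
  next
    case (Suc n)
    then obtain r where r: "?r n = Suc r" by (cases "?r n") auto
    with Suc show ?case using Prec.IH(2) by (auto intro: eval.Prec_Suc)
  qed
  then show ?case using Prec.prems xs by simp
next
  case (Mu g)
  let ?step = "\<lambda>m r. if r = 0
        then (if bounded_eval f b g (m # xs) = 0 then 1
              else if bounded_eval f b g (m # xs) - 1 = 0 then Suc (Suc m) else 0)
        else r"
  \<comment> \<open>State \<open>0\<close> certifies positive values at all arguments below
    \<open>c\<close>, which is what \<open>eval.Mu\<close> demands before the first zero. After a
    failure of the body the state stays \<open>1\<close>, about which nothing is claimed.\<close>
  have inv: "(rec_nat 0 ?step c = 0 \<longrightarrow> (\<forall>m<c. \<exists>y>0. eval f g (m # xs) y)) \<and>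
      (\<forall>n. rec_nat 0 ?step c = Suc (Suc n) \<longrightarrow> eval f (Mu g) xs n)" for c
  proof (induction c)
    case 0
    then show ?case by simp
  next
    case (Suc c)
    have c: "bounded_eval f b g (c # xs) - 1 = 0 \<or> (\<exists>y>0. eval f g (c # xs) y)"
      using Mu.IH[of "c # xs" "bounded_eval f b g (c # xs) - 1"]
      by (cases "bounded_eval f b g (c # xs)") auto
    have c0: "bounded_eval f b g (c # xs) = Suc 0 \<Longrightarrow> eval f g (c # xs) 0"
      by (rule Mu.IH)
    show ?case
    proof (cases "rec_nat 0 ?step c = 0")
      case True
      then show ?thesis using Suc c c0
        by (cases "bounded_eval f b g (c # xs)") (auto simp: less_Suc_eq intro: eval.Mu)
    next
      case False
      then show ?thesis using Suc by simp
    qed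
  qed
  from Mu.prems have "rec_nat 0 ?step b = Suc (Suc y)" by simp
  then show ?case using inv by blast
qed

text \<open>A convergent computation consults finitely many oracle values and searches only finitely
  far. A single \<open>l\<close> bounds both, because the code of a finite oracle will later serve
  as the search bound too.\<close>

lemma bounded_eval_complete:
  "eval f p xs y \<Longrightarrow>
    \<exists>l. \<forall>f' b. (\<forall>z<l. f' z = f z) \<longrightarrow> l \<le> b \<longrightarrow> bounded_eval f' b p xs = Suc y"
proof (induction rule: eval.induct)
  case (Oracle x)
  show ?case by (rule exI[of _ "Suc x"]) simp
next
  case (Comp xs gs ys h z)
  let ?P = "\<lambda>g y l. \<forall>f' b. (\<forall>z<l. f' z = f z) \<longrightarrow> l \<le> b \<longrightarrow> bounded_eval f' b g xs = Suc y"
  have len: "length gs = length ys" using Comp.IH(1) by (rule list_all2_lengthD)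
  have "\<forall>i. \<exists>l. i < length gs \<longrightarrow> ?P (gs ! i) (ys ! i) l"
    using Comp.IH(1) by (auto simp: list_all2_conv_all_nth)
  then obtain L where L: "\<And>i. i < length gs \<Longrightarrow> ?P (gs ! i) (ys ! i) (L i)"
    by metis
  obtain l where l: "\<forall>f' b. (\<forall>z<l. f' z = f z) \<longrightarrow> l \<le> b \<longrightarrow> bounded_eval f' b h ys = Suc z"
    using Comp.IH(2) by blast
  define M where "M = max l (Max (insert 0 (L ` {..<length gs})))"
  have M: "l \<le> M" "\<And>i. i < length gs \<Longrightarrow> L i \<le> M"
    by (auto simp: M_def le_max_iff_disj)
  show ?case
  proof (intro exI[of _ M] allI impI)
    fix f' b assume a: "\<forall>z<M. f' z = f z" "M \<le> b"
    have "bounded_eval f' b (gs ! i) xs = Suc (ys ! i)" if "i < length gs" for i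
      using L[OF that] M(2)[OF that] a by (meson dual_order.strict_trans1 le_trans)
    then have "map (\<lambda>g. bounded_eval f' b g xs) gs = map Suc ys"
      using len by (auto intro: nth_equalityI)
    moreover from this have "map (\<lambda>g. bounded_eval f' b g xs - 1) gs = ys"
      using len by (auto intro!: nth_equalityI simp: list_eq_iff_nth_eq)
    moreover have "bounded_eval f' b h ys = Suc z"
      using l M(1) a by (meson dual_order.strict_trans1 le_trans)
    ultimately show "bounded_eval f' b (Comp h gs) xs = Suc z"
      by (simp only: bounded_eval.simps) auto
  qed
next
  case (Prec_Suc g h n xs y z)
  then obtain l l' where
    "\<forall>f' b. (\<forall>z<l. f' z = f z) \<longrightarrow> l \<le> b \<longrightarrow> bounded_eval f' b (Prec g h) (n # xs) = Suc y"
    "\<forall>f' b. (\<forall>z<l'. f' z = f z) \<longrightarrow> l' \<le> b \<longrightarrow> bounded_eval f' b h (n # y # xs) = Suc z"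
    by blast
  then show ?case by (intro exI[of _ "max l l'"]) auto
next
  case (Mu g n xs)
  let ?P = "\<lambda>m y l. \<forall>f' b. (\<forall>z<l. f' z = f z) \<longrightarrow> l \<le> b \<longrightarrow> bounded_eval f' b g (m # xs) = Suc y"
  from Mu.IH obtain l0 where l0: "?P n 0 l0" by blast
  have "\<forall>m. \<exists>y l. m < n \<longrightarrow> 0 < y \<and> ?P m y l" using Mu.IH(2) by blast
  then obtain Y L where L: "\<And>m. m < n \<Longrightarrow> 0 < Y m \<and> ?P m (Y m) (L m)" by metis
  define M where "M = max (Suc n) (max l0 (Max (insert 0 (L ` {..<n}))))"
  have M: "l0 \<le> M" "Suc n \<le> M" "\<And>m. m < n \<Longrightarrow> L m \<le> M"
    by (auto simp: M_def le_max_iff_disj)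
  show ?case
  proof (intro exI[of _ M] allI impI)
    fix f' b assume a: "\<forall>z<M. f' z = f z" "M \<le> b"
    have n: "bounded_eval f' b g (n # xs) = Suc 0"
      using l0 M(1) a by (meson dual_order.strict_trans1 le_trans)
    have m: "bounded_eval f' b g (m # xs) = Suc (Y m)" "0 < Y m" if "m < n" for m
      using L[OF that] M(3)[OF that] a by (meson dual_order.strict_trans1 le_trans)+
    let ?step = "\<lambda>m r. if r = 0
        then (if bounded_eval f' b g (m # xs) = 0 then 1
              else if bounded_eval f' b g (m # xs) - 1 = 0 then Suc (Suc m) else 0)
        else r"
    have "c \<le> n \<Longrightarrow> rec_nat 0 ?step c = 0" for c
      by (induction c) (use m in auto)
    then have "rec_nat 0 ?step (Suc n) = Suc (Suc n)" using n by simp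
    then have "rec_nat 0 ?step (Suc n + d) = Suc (Suc n)" for d
      by (induction d) auto
    from this[of "b - Suc n"] have "rec_nat 0 ?step b = Suc (Suc n)" using M(2) a(2) by simp
    then show "bounded_eval f' b (Mu g) xs = Suc n"
      by simp
  qed
qed auto

text \<open>The use principle: the simulation with search bound \<open>l\<close> already converges
  on every oracle that agrees below \<open>l\<close>.\<close>

lemma eval_finite_use:
  assumes "eval f p xs y"
  shows "\<exists>l. \<forall>f'. (\<forall>z<l. f' z = f z) \<longrightarrow> eval f' p xs y"
  using bounded_eval_complete[OF assms] bounded_eval_sound by (meson order_refl)

section \<open>The bounded simulation as a program\<close>

definition Pred :: recf where "Pred = Prec Zero (Proj 0)"

lemma eval_Pred: "eval f Pred [x] (x - 1)"
proof (induction x)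
  case 0
  show ?case unfolding Pred_def by (auto intro!: eval.Prec_0 eval.Zero)
next
  case (Suc x)
  show ?case unfolding Pred_def
    by (rule eval.Prec_Suc[OF Suc[unfolded Pred_def]]) (rule eval_Proj', auto)
qed

lemma eval_Comp_Pred: "eval f g xs y \<Longrightarrow> z = y - 1 \<Longrightarrow> eval f (Comp Pred [g]) xs z"
  using eval_Comp1 eval_Pred by blast

text \<open>\<open>Bounded Q k p\<close> computes the bounded evaluation of \<open>p\<close> on tuples of length \<open>k\<close>; the
  bound is passed as an additional last argument, and \<open>Q\<close> answers oracle queries, depending
  on that bound.\<close>

fun Bounded :: "recf \<Rightarrow> nat \<Rightarrow> recf \<Rightarrow> recf" where
  "Bounded Q k Zero = Numeral 1"
| "Bounded Q k Succ = (if k = 1 then Comp Succ [Comp Succ [Proj 0]] else Zero)"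
| "Bounded Q k (Proj i) = (if i < k then Comp Succ [Proj i] else Zero)"
| "Bounded Q k Oracle = (if k = 1 then Comp Succ [Q] else Zero)"
| "Bounded Q k (Comp h gs) =
    Cond (foldr (\<lambda>q c. Cond q Zero c) (map (Bounded Q k) gs) (Numeral 1))
      Zero
      (Comp (Bounded Q (length gs) h) (map (\<lambda>g. Comp Pred [Bounded Q k g]) gs @ [Proj k]))"
| "Bounded Q k (Prec g h) = (if k = 0 then Zero else
    Prec (Bounded Q (k - 1) g)
      (Cond (Proj 1) Zero
        (Comp (Bounded Q (Suc k) h)
          (Proj 0 # Comp Pred [Proj 1] # map (\<lambda>i. Proj (Suc (Suc i))) [0..<k]))))"
| "Bounded Q k (Mu g) =
    (let G = Comp (Bounded Q (Suc k) g) (Proj 0 # map (\<lambda>i. Proj (Suc (Suc i))) [0..<Suc k]) in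
     Comp Pred [Comp
       (Prec Zero
         (Cond (Proj 1)
           (Cond G (Numeral 1) (Cond (Comp Pred [G]) (Comp Succ [Comp Succ [Proj 0]]) Zero))
           (Proj 1)))
       (Proj k # map Proj [0..<Suc k])])"

text \<open>\<open>Cond\<close> evaluates both branches, so the case distinctions rely on the
  totality of the simulation: a failed argument still receives a dummy value from
  \<open>Pred\<close>, and the result computed from it is discarded.\<close>

lemma eval_Bounded:
  assumes Q: "\<And>x. eval h Q [x, b] (f x)"
  shows "length xs = k \<Longrightarrow> eval h (Bounded Q k p) (xs @ [b]) (bounded_eval f b p xs)"
proof (induction p arbitrary: k xs)
  case Zero
  show ?case using eval_Numeral[of h 1] by simp
next
  case Succ
  then show ?case
    by (auto simp: length_Suc_conv intro!: eval.Zero eval_Comp_Succ eval_Proj')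
next
  case (Proj i)
  then show ?case
    by (auto simp: nth_append intro!: eval.Zero eval_Comp_Succ[OF eval_Proj'[OF _ refl]])
next
  case Oracle
  then show ?case using Q
    by (auto simp: length_Suc_conv intro!: eval.Zero eval_Comp_Succ)
next
  case (Comp p gs)
  let ?v = "\<lambda>g. bounded_eval f b g xs"
  have nz: "eval h (foldr (\<lambda>q c. Cond q Zero c) (map (Bounded Q k) gs) (Numeral 1)) (xs @ [b])
      (if 0 \<in> set (map ?v gs) then 0 else 1)"
    using Comp.IH(2) Comp.prems
  proof (induction gs)
    case Nil
    then show ?case using eval_Numeral[of h 1] by simp
  next
    case (Cons g gs)
    have "eval h (foldr (\<lambda>q c. Cond q Zero c) (map (Bounded Q k) gs) (Numeral 1)) (xs @ [b])
      (if 0 \<in> set (map ?v gs) then 0 else 1)"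
      using Cons by simp
    moreover have "eval h (Bounded Q k g) (xs @ [b]) (?v g)"
      using Cons.prems by simp
    ultimately show ?case
      by (simp only: list.map foldr.simps o_apply, intro eval_Cond[OF _ eval.Zero]) auto
  qed
  have "list_all2 (\<lambda>g y. eval h g (xs @ [b]) y)
      (map (\<lambda>g. Comp Pred [Bounded Q k g]) gs @ [Proj k]) (map (\<lambda>g. ?v g - 1) gs @ [b])"
    by (rule list_all2_appendI)
      (use Comp.IH(2) Comp.prems in \<open>auto simp: list_all2_conv_all_nth intro!: eval_Comp_Pred eval_Proj'\<close>)
  moreover have "eval h (Bounded Q (length gs) p) (map (\<lambda>g. ?v g - 1) gs @ [b])
      (bounded_eval f b p (map (\<lambda>g. ?v g - 1) gs))"
    by (rule Comp.IH(1)) simp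
  ultimately show ?case
    unfolding Bounded.simps bounded_eval.simps
    by (intro eval_Cond[OF nz eval.Zero eval.Comp]) auto
next
  case (Prec p q)
  show ?case
  proof (cases xs)
    case Nil
    then show ?thesis using Prec.prems by (auto intro: eval.Zero)
  next
    case (Cons n ys)
    let ?H = "Cond (Proj 1) Zero
        (Comp (Bounded Q (Suc k) q)
          (Proj 0 # Comp Pred [Proj 1] # map (\<lambda>i. Proj (Suc (Suc i))) [0..<k]))"
    have "eval h (Prec (Bounded Q (k - 1) p) ?H) (n # ys @ [b]) (bounded_eval f b (Prec p q) (n # ys))"
    proof (induction n)
      case 0
      then show ?case using Prec.IH(1)[of ys "k - 1"] Prec.prems Cons by (auto intro: eval.Prec_0)
    next
      case (Suc n)
      let ?r = "bounded_eval f b (Prec p q) (n # ys)"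
      let ?zs = "n # ?r # ys @ [b]"
      have "list_all2 (\<lambda>g y. eval h g ?zs y) (map (\<lambda>i. Proj (Suc (Suc i))) [0..<k]) (ys @ [b])"
        using Prec.prems Cons
        by (auto simp: list_all2_conv_all_nth simp del: upt_Suc bounded_eval.simps intro!: eval_Proj')
      then have "list_all2 (\<lambda>g y. eval h g ?zs y)
          (Proj 0 # Comp Pred [Proj 1] # map (\<lambda>i. Proj (Suc (Suc i))) [0..<k]) (n # (?r - 1) # ys @ [b])"
        by (auto simp del: upt_Suc bounded_eval.simps
            intro!: eval_Comp_Pred[OF eval_Proj'[OF _ refl]] eval_Proj')
      moreover have "eval h (Bounded Q (Suc k) q) (n # (?r - 1) # ys @ [b])
          (bounded_eval f b q (n # (?r - 1) # ys))"
        using Prec.IH(2)[of "n # (?r - 1) # ys" "Suc k"] Prec.prems Cons by simp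
      ultimately have "eval h ?H ?zs (if ?r = 0 then 0 else bounded_eval f b q (n # (?r - 1) # ys))"
        by (intro eval_Cond[where k = ?r, OF _ eval.Zero eval.Comp refl])
          (auto intro: eval_Proj' simp del: bounded_eval.simps)
      moreover have "bounded_eval f b (Prec p q) (Suc n # ys) =
          (if ?r = 0 then 0 else bounded_eval f b q (n # (?r - 1) # ys))"
        by simp
      ultimately show ?case using eval.Prec_Suc[OF Suc] by (simp only:)
    qed
    then show ?thesis using Cons Prec.prems by auto
  qed
next
  case (Mu p)
  define G where
    "G = Comp (Bounded Q (Suc k) p) (Proj 0 # map (\<lambda>i. Proj (Suc (Suc i))) [0..<Suc k])"
  define H where "H = Cond (Proj 1)
      (Cond G (Numeral 1) (Cond (Comp Pred [G]) (Comp Succ [Comp Succ [Proj 0]]) Zero)) (Proj 1)"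
  let ?step = "\<lambda>m r. if r = 0
        then (if bounded_eval f b p (m # xs) = 0 then 1
              else if bounded_eval f b p (m # xs) - 1 = 0 then Suc (Suc m) else 0)
        else r"
  have G: "eval h G (m # r # xs @ [b]) (bounded_eval f b p (m # xs))" for m r
    unfolding G_def
  proof (rule eval.Comp)
    have "list_all2 (\<lambda>g y. eval h g (m # r # xs @ [b]) y)
        (map (\<lambda>i. Proj (Suc (Suc i))) [0..<Suc k]) (xs @ [b])"
      using Mu.prems by (auto simp: list_all2_conv_all_nth simp del: upt_Suc intro!: eval_Proj')
    then show "list_all2 (\<lambda>g y. eval h g (m # r # xs @ [b]) y)
        (Proj 0 # map (\<lambda>i. Proj (Suc (Suc i))) [0..<Suc k]) (m # xs @ [b])"
      by (auto simp del: upt_Suc intro!: eval_Proj')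
    show "eval h (Bounded Q (Suc k) p) (m # xs @ [b]) (bounded_eval f b p (m # xs))"
      using Mu.IH[of "m # xs" "Suc k"] Mu.prems by simp
  qed
  have H: "eval h H (m # r # xs @ [b]) (?step m r)" for m r
    unfolding H_def
    by (rule eval_Cond[OF eval_Proj'[OF _ refl]
          eval_Cond[OF G eval_Numeral
            eval_Cond[OF eval_Comp_Pred[OF G refl]
              eval_Comp_Succ[OF eval_Comp_Succ[OF eval_Proj'[OF _ refl] refl] refl]
              eval.Zero refl] refl]
          eval_Proj'[OF _ refl]]) simp_all
  have "eval h (Prec Zero H) (c # xs @ [b]) (rec_nat 0 ?step c)" for c
  proof (induction c)
    case 0
    show ?case by (auto intro: eval.Prec_0 eval.Zero)
  next
    case (Suc c)
    from eval.Prec_Suc[OF Suc H] show ?case by simp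
  qed
  moreover have "list_all2 (\<lambda>g y. eval h g (xs @ [b]) y) (map Proj [0..<Suc k]) (xs @ [b])"
    using Mu.prems by (auto simp: list_all2_conv_all_nth simp del: upt_Suc intro!: eval_Proj')
  ultimately have "eval h (Comp (Prec Zero H) (Proj k # map Proj [0..<Suc k])) (xs @ [b])
      (rec_nat 0 ?step b)"
    by (intro eval.Comp[where ys = "b # xs @ [b]"])
      (use Mu.prems in \<open>auto simp del: upt_Suc intro!: eval_Proj'\<close>)
  from eval_Comp_Pred[OF this refl] show ?case
    by (simp only: Bounded.simps Let_def bounded_eval.simps G_def H_def)
qed

text \<open>A number, read in binary, serves as a finite 0/1-valued oracle, continued by zeros.\<close>

definition bit_fun :: "nat \<Rightarrow> nat \<Rightarrow> nat" where
  "bit_fun n x = n div 2 ^ x mod 2"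

definition Bit :: recf where
  "Bit = Comp Parity [Prec (Proj 0) (Comp Half [Proj 1])]"

lemma eval_Bit: "eval f Bit [x, n] (bit_fun n x)"
proof -
  have "eval f (Prec (Proj 0) (Comp Half [Proj 1])) [x, n] (n div 2 ^ x)"
  proof (induction x)
    case 0
    show ?case by (auto intro!: eval.Prec_0 eval_Proj')
  next
    case (Suc x)
    have "n div 2 ^ Suc x = n div 2 ^ x div 2"
      by (metis div_mult2_eq power_Suc2)
    with eval.Prec_Suc[OF Suc eval_Comp1[OF eval_Proj'[OF _ refl] eval_Half]] show ?case by simp
  qed
  then show ?thesis unfolding Bit_def bit_fun_def using eval_Parity by (rule eval_Comp1)
qed

text \<open>The code must also be large, since it doubles as a search bound. The recursion doubles
  it at each digit and starts from a positive number, which acts as a leading 1 beyond the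
  prescribed digits.\<close>

lemma bit_fun_extends:
  assumes "\<And>x. f x < (2::nat)"
  obtains n where "l \<le> n" "\<And>x. x < l \<Longrightarrow> bit_fun n x = f x"
proof -
  have "\<exists>n. l < n \<and> (\<forall>x<l. bit_fun n x = f x)" for l
    using assms
  proof (induction l arbitrary: f)
    case 0
    then show ?case by auto
  next
    case (Suc l)
    from Suc.IH[of "\<lambda>x. f (Suc x)"] Suc.prems obtain n where
      n: "l < n" "\<And>x. x < l \<Longrightarrow> bit_fun n x = f (Suc x)" by auto
    have bit0: "bit_fun (2 * m + f 0) 0 = f 0" for m
      using Suc.prems[of 0] by (simp add: bit_fun_def)
    have bitS: "bit_fun (2 * m + f 0) (Suc x) = bit_fun m x" for m x
      using Suc.prems[of 0] by (simp add: bit_fun_def div_mult2_eq)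
    have "bit_fun (2 * n + f 0) x = f x" if "x < Suc l" for x
      using that n(2) bit0 bitS by (cases x) auto
    then show ?case using n(1) by (intro exI[of _ "2 * n + f 0"]) auto
  qed
  then show ?thesis using that less_imp_le by blast
qed

text \<open>The second argument \<open>n\<close>, supplied by \<open>Bounded\<close> as the search
  bound, is read here as a finite oracle. One search over \<open>n\<close> thus runs through
  segments and bounds at once.\<close>

definition Query :: recf where
  "Query = Cond (Comp Parity [Proj 0])
    (Comp Bit [Comp Half [Proj 0], Proj 1]) (Comp Oracle [Comp Half [Proj 0]])"

lemma eval_Query: "eval h Query [x, n] (fun_join (bit_fun n) h x)"
  unfolding Query_def
  by (rule eval_Cond[OF eval_Comp1[OF eval_Proj'[OF _ refl] eval_Parity]
        eval.Comp[OF _ eval_Bit[where n = n and x = "x div 2"]]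
        eval_Comp_Oracle[OF eval_Comp1[OF eval_Proj'[OF _ refl] eval_Half] refl]])
    (auto simp: fun_join_def even_iff_mod_2_eq_zero intro!: eval_Comp1[OF eval_Proj' eval_Half] eval_Proj')

section \<open>Turing reducibility\<close>

definition turing_le :: "(nat \<Rightarrow> nat) \<Rightarrow> (nat \<Rightarrow> nat) \<Rightarrow> bool" where
  "turing_le g f \<longleftrightarrow> (\<exists>p. computes p f g)"

lemma turing_leI: "computes p f g \<Longrightarrow> turing_le g f"
  unfolding turing_le_def by blast

lemma turing_le_refl: "turing_le f f"
  by (rule turing_leI[of Oracle]) (auto simp: computes_def intro: eval.Oracle)

lemma turing_le_trans: "turing_le f g \<Longrightarrow> turing_le g h \<Longrightarrow> turing_le f h"
  unfolding turing_le_def by (meson computes_subst)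

lemma turing_le_fun_cons: "turing_le (fun_cons i f) f" "turing_le f (fun_cons i f)"
  using computes_Prepend computes_Tail by (blast intro: turing_leI)+

lemma turing_le_fun_join: "turing_le f (fun_join f g)" "turing_le g (fun_join f g)"
proof -
  have "\<exists>k\<in>{f}. turing_le k (fun_join f g)" "\<exists>k\<in>{g}. turing_le k (fun_join f g)"
    using mass_join_upper1[of "{f}" "{g}"] mass_join_upper2[of "{g}" "{f}"]
    by (auto simp: medvedev_le_def mass_join_def turing_le_def)
  then show "turing_le f (fun_join f g)" "turing_le g (fun_join f g)" by auto
qed

lemma turing_le_fun_join_least:
  assumes "turing_le f h" "turing_le g h"
  shows "turing_le (fun_join f g) h"
proof -
  have "medvedev_le {f} {h}" "medvedev_le {g} {h}"
    using assms by (auto simp: medvedev_le_def turing_le_def)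
  then have "medvedev_le (mass_join {f} {g}) {h}" by (rule mass_join_least)
  then show ?thesis by (auto simp: medvedev_le_def mass_join_def turing_le_def)
qed

text \<open>The values below \<open>l\<close> are replaced one at a time: shift both functions, then
  prepend the new first value.\<close>

lemma turing_le_finite_change:
  "(\<And>z. l \<le> z \<Longrightarrow> g z = f z) \<Longrightarrow> turing_le g f"
proof (induction l arbitrary: f g)
  case 0
  then have "g = f" by auto
  then show ?case by (simp add: turing_le_refl)
next
  case (Suc l)
  have cons: "h = fun_cons (h 0) (\<lambda>z. h (Suc z))" for h
    by (auto simp: fun_cons_def split: nat.split)
  have "turing_le (\<lambda>z. g (Suc z)) (\<lambda>z. f (Suc z))"
    using Suc by auto
  then have "turing_le (fun_cons (g 0) (\<lambda>z. g (Suc z))) (fun_cons (f 0) (\<lambda>z. f (Suc z)))"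
    by (intro turing_le_trans[OF turing_le_fun_cons(1)] turing_le_trans[OF _ turing_le_fun_cons(2)])
  then show ?case
    by (simp flip: cons)
qed

subsection \<open>An infinite antichain\<close>

instance recf :: countable
  by countable_datatype

text \<open>A Baire category argument: every finite segment extends to one that forces membership in
  \<open>D k\<close>. Meeting these conditions in turn gives growing segments with union
  \<open>G\<close>.\<close>

lemma finite_extension_method:
  fixes D :: "nat \<Rightarrow> (nat \<Rightarrow> 'a) set"
  assumes "\<And>k f l. \<exists>g l'. (\<forall>z<l. g z = f z) \<and> (\<forall>h. (\<forall>z<l'. h z = g z) \<longrightarrow> h \<in> D k)"
  shows "\<exists>G. \<forall>k. G \<in> D k"
proof -
  let ?R = "\<lambda>k s t. (\<forall>z<snd s. fst t z = fst s z) \<and> (\<forall>h. (\<forall>z<snd t. h z = fst t z) \<longrightarrow> h \<in> D k)"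
  have ex: "\<exists>t. ?R k s t" for k and s :: "(nat \<Rightarrow> 'a) \<times> nat"
    using assms[of "snd s" "fst s" k] by auto
  define N where "N k s = (SOME t. ?R k s t)" for k s
  have N: "?R k s (N k s)" for k s
    unfolding N_def by (rule someI_ex[OF ex])
  \<comment> \<open>A stage is a function together with the length up to which it is fixed. The
    maximum with \<open>Suc (snd s)\<close> makes the lengths grow without bound, so that
    \<open>G\<close> is determined everywhere.\<close>
  define s where "s = rec_nat (undefined, 0) (\<lambda>k s. (fst (N k s), max (Suc (snd s)) (snd (N k s))))"
  define f l where "f k = fst (s k)" and "l k = snd (s k)" for k
  have step: "f (Suc k) = fst (N k (s k))" "l (Suc k) = max (Suc (l k)) (snd (N k (s k)))" for k
    by (simp_all add: f_def l_def s_def)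
  have F: "z < l k \<Longrightarrow> f (Suc k) z = f k z" for z k
    using N[of "s k" k] by (simp add: step(1)) (simp add: f_def l_def)
  have L: "(\<And>z. z < l (Suc k) \<Longrightarrow> h z = f (Suc k) z) \<Longrightarrow> h \<in> D k" for h k
    using N[of "s k" k] by (simp add: step)
  have mono: "l k \<le> l (k + d)" for k d
    by (induction d) (auto simp: step)
  have agree: "z < l k \<Longrightarrow> f (k + d) z = f k z" for k d z
  proof (induction d)
    case (Suc d)
    then show ?case using mono[of k d] by (simp add: F)
  qed simp
  have large: "k \<le> l k" for k
    by (induction k) (auto simp: step)
  \<comment> \<open>Stage \<open>Suc z\<close> has fixed more than \<open>z\<close> values, so
    argument \<open>z\<close> no longer changes.\<close>
  define G where "G z = f (Suc z) z" for z
  have G: "G z = f k z" if "z < l k" for k z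
  proof (cases "k \<le> Suc z")
    case True
    then show ?thesis using agree[OF that, of "Suc z - k"] by (simp add: G_def)
  next
    case False
    then show ?thesis using agree[of z "Suc z" "k - Suc z"] large[of "Suc z"] by (simp add: G_def)
  qed
  have "G \<in> D k" for k
    by (rule L) (rule G)
  then show ?thesis by blast
qed

text \<open>The Kleene-Post construction, for all columns of one function \<open>G\<close> at once.
  Each condition \<open>D k\<close> says that one program fails to compute one column from another;
  parities make the columns 0/1-valued.\<close>

lemma infinite_turing_antichain:
  obtains x :: "nat \<Rightarrow> nat \<Rightarrow> nat"
  where "\<And>i z. x i z < 2" "\<And>i j. i \<noteq> j \<Longrightarrow> \<not> turing_le (x i) (x j)"
proof -
  define col where "col G i = (\<lambda>m. G (prod_encode (i, m)) mod 2)" for G :: "nat \<Rightarrow> nat" and i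
  define D where "D k = {G. case from_nat k of (p, i :: nat, j :: nat) \<Rightarrow>
      i \<noteq> j \<longrightarrow> \<not> computes p (col G j) (col G i)}" for k
  have "\<exists>g l'. (\<forall>z<l. g z = f z) \<and> (\<forall>h. (\<forall>z<l'. h z = g z) \<longrightarrow> h \<in> D k)" for k l and f :: "nat \<Rightarrow> nat"
  proof -
    obtain p :: recf and i j :: nat where k: "from_nat k = (p, i, j)" by (metis prod_cases3)
    show ?thesis
    \<comment> \<open>If no extension lets \<open>p\<close> succeed, the given segment already
      forces \<open>D k\<close>.\<close>
    proof (cases "i \<noteq> j \<and> (\<exists>G. (\<forall>z<l. G z = f z) \<and> computes p (col G j) (col G i))")
      case False
      then show ?thesis using k by (intro exI[of _ f] exI[of _ l]) (auto simp: D_def)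
    next
      case True
      then obtain G where ij: "i \<noteq> j" and G: "\<forall>z<l. G z = f z"
        and comp: "computes p (col G j) (col G i)" by blast
      \<comment> \<open>Position \<open>w\<close> holds argument \<open>l\<close> of column
        \<open>i\<close>. It lies beyond the given segment and outside column \<open>j\<close>, so
        changing it alters the value to be computed but not the oracle.\<close>
      define w where "w = prod_encode (i, l)"
      have "l \<le> w" by (simp add: w_def le_prod_encode_2)
      have "eval (col G j) p [l] (col G i l)" using comp by (simp add: computes_def)
      then obtain u where
        u: "\<forall>f'. (\<forall>z<u. f' z = col G j z) \<longrightarrow> eval f' p [l] (col G i l)"
        using eval_finite_use by blast
      \<comment> \<open>The new segment covers \<open>w\<close> and every position that the
        computation consults in column \<open>j\<close>.\<close>
      define l' where "l' = Suc (w + (\<Sum>m<u. prod_encode (j, m)))"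
      have l': "w < l'" "\<And>m. m < u \<Longrightarrow> prod_encode (j, m) < l'"
        unfolding l'_def using member_le_sum[of _ "{..<u}" "\<lambda>m. prod_encode (j, m)"]
        by (auto intro!: le_imp_less_Suc trans_le_add2)
      have "h \<in> D k" if h: "\<forall>z<l'. h z = (G(w := Suc (G w))) z" for h
      proof -
        have "col h j m = col G j m" if "m < u" for m
          using h l'(2)[OF that] ij by (simp add: col_def w_def prod_encode_eq)
        then have "eval (col h j) p [l] (col G i l)" using u by blast
        moreover have "col h i l \<noteq> col G i l"
          using h l'(1) by (simp add: col_def w_def[symmetric]) presburger
        ultimately have "\<not> computes p (col h j) (col h i)"
          unfolding computes_def using eval_deterministic by blast
        then show ?thesis by (simp add: D_def k)
      qed
      then show ?thesis using G \<open>l \<le> w\<close>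
        by (intro exI[of _ "G(w := Suc (G w))"] exI[of _ l']) auto
    qed
  qed
  then obtain G where G: "\<And>k. G \<in> D k" using finite_extension_method[of D] by blast
  have "\<not> turing_le (col G i) (col G j)" if "i \<noteq> j" for i j
  proof
    assume "turing_le (col G i) (col G j)"
    then obtain p where "computes p (col G j) (col G i)" by (auto simp: turing_le_def)
    then show False using G[of "to_nat (p, i, j)"] that by (simp add: D_def)
  qed
  then show ?thesis by (intro that[of "col G"]) (auto simp: col_def)
qed

section \<open>Finite meets of mass problems\<close>

text \<open>An iterated meet whose selected component is readable from the single value at
  \<open>0\<close>; nested binary meets would spread it over several values.\<close>

definition tagged :: "mass_problem list \<Rightarrow> mass_problem" where
  "tagged Bs = {fun_cons k f | k f. k < length Bs \<and> f \<in> Bs ! k}"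

lemma medvedev_le_tagged_Cons:
  "medvedev_le (mass_meet B (tagged Bs)) (tagged (B # Bs))"
proof -
  define hd where "hd = Comp Oracle [Zero]"
  \<comment> \<open>A tag \<open>0\<close> is kept; a positive tag \<open>k\<close> is replaced by
    the two values \<open>1\<close> and \<open>k - 1\<close>.\<close>
  define r where "r = Prec (Cond hd Zero (Numeral 1))
    (Cond hd (Comp Oracle [Comp Succ [Proj 0]])
      (Cond (Proj 0) (Comp Pred [hd]) (Comp Oracle [Proj 0])))"
  have hd: "eval (fun_cons k f) hd xs k" for k f xs
    unfolding hd_def by (auto simp: fun_cons_def intro!: eval_Comp_Oracle[OF eval.Zero])
  have r: "computes r (fun_cons k f)
      (if k = 0 then fun_cons 0 f else fun_cons 1 (fun_cons (k - 1) f))" (is "computes r ?o ?g") for k f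
    unfolding computes_def
  proof
    fix x
    show "eval ?o r [x] (?g x)"
    proof (induction x)
      case 0
      show ?case unfolding r_def
        by (rule eval.Prec_0, rule eval_Cond[OF hd eval.Zero eval_Numeral])
          (auto simp: fun_cons_def)
    next
      case (Suc x)
      show ?case unfolding r_def
        by (rule eval.Prec_Suc[OF Suc[unfolded r_def]],
            rule eval_Cond[OF hd eval_Comp_Oracle[OF eval_Comp_Succ[OF eval_Proj'[OF _ refl] refl] refl]
              eval_Cond[OF eval_Proj'[OF _ refl] eval_Comp_Pred[OF hd refl]
                eval_Comp_Oracle[OF eval_Proj'[OF _ refl] refl] refl]])
          (auto simp: fun_cons_def split: nat.split)
    qed
  qed
  show ?thesis
  proof (rule medvedev_leI[where p = r])
    fix h assume "h \<in> tagged (B # Bs)"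
    then obtain k f where "h = fun_cons k f" "k < Suc (length Bs)" "f \<in> (B # Bs) ! k"
      by (auto simp: tagged_def)
    then show "\<exists>g\<in>mass_meet B (tagged Bs). computes r h g"
      using r[of k f] by (cases k) (fastforce simp: mass_meet_def tagged_def)+
  qed
qed

lemma medvedev_le_tagged_iff:
  "medvedev_le R (tagged Bs) \<longleftrightarrow> (\<forall>B\<in>set Bs. medvedev_le R B)"
proof
  assume R: "medvedev_le R (tagged Bs)"
  show "\<forall>B\<in>set Bs. medvedev_le R B"
  proof
    fix B assume "B \<in> set Bs"
    then obtain k where "k < length Bs" "B = Bs ! k" by (auto simp: in_set_conv_nth)
    then have "medvedev_le (tagged Bs) B"
      using computes_Prepend[of k] by (intro medvedev_leI[where p = "Prepend k"]) (auto simp: tagged_def)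
    with R show "medvedev_le R B" by (rule medvedev_le_trans)
  qed
next
  show "\<forall>B\<in>set Bs. medvedev_le R B \<Longrightarrow> medvedev_le R (tagged Bs)"
  proof (induction Bs)
    case Nil
    then show ?case by (auto simp: tagged_def intro: medvedev_leI)
  next
    case (Cons B Bs)
    then have "medvedev_le R (mass_meet B (tagged Bs))"
      by (auto intro: mass_meet_greatest)
    then show ?case using medvedev_le_tagged_Cons by (rule medvedev_le_trans)
  qed
qed

section \<open>Avoiding lower cones\<close>

locale turing_antichain =
  fixes x :: "nat \<Rightarrow> nat \<Rightarrow> nat"
  assumes binary: "x i z < 2"
    and antichain: "i \<noteq> j \<Longrightarrow> \<not> turing_le (x i) (x j)"
begin

definition avoid :: "nat set \<Rightarrow> mass_problem" where
  "avoid E = {f. \<forall>i\<in>E. \<not> turing_le f (x i)}"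

text \<open>The index \<open>k\<close> is found from \<open>h\<close> alone, so the output can be
  \<open>h\<close> itself behind \<open>k\<close>. Every \<open>x i\<close> with
  \<open>i \<notin> E\<close> continues the segment found without changing the selection.\<close>

lemma medvedev_le_avoid_diff:
  assumes "finite E" and le: "medvedev_le (tagged (map avoid Es)) (mass_join (avoid E) C)"
  shows "medvedev_le (tagged (map (\<lambda>E'. avoid (E' - E)) Es)) C"
proof -
  from le obtain p where p: "\<And>f h. f \<in> avoid E \<Longrightarrow> h \<in> C \<Longrightarrow>
      \<exists>g\<in>tagged (map avoid Es). computes p (fun_join f h) g"
    unfolding medvedev_le_def mass_join_def by blast
  define B where "B = Comp (Bounded Query 1 p) [Zero, Proj 0]"
  \<comment> \<open>\<open>Cond\<close> swaps zero and nonzero because \<open>Mu\<close> looks for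
    zeros: the search stops at the least \<open>n\<close> on which the simulation of
    \<open>p\<close> at argument \<open>0\<close> succeeds, and \<open>Pred\<close> removes the
    success mark.\<close>
  define K where "K = Comp Pred [Comp B [Mu (Cond B (Numeral 1) Zero)]]"
  define r where "r = Prec K (Comp Oracle [Proj 0])"
  have B: "eval h B [n] (bounded_eval (fun_join (bit_fun n) h) n p [0])" for h n
    unfolding B_def
    by (rule eval.Comp[where ys = "[0, n]"])
      (use eval_Bounded[OF eval_Query, where xs = "[0]" and k = 1] in
        \<open>auto intro: eval.Zero eval_Proj'\<close>)
  \<comment> \<open>A finite variant \<open>f\<close> of \<open>x i\<close> computes
    \<open>x i\<close>; if \<open>x k\<close> computed \<open>f\<close>, the antichain property
    would give \<open>k = i\<close>.\<close>
  have x_avoid: "f \<in> avoid E" if "i \<notin> E" "\<And>z. l \<le> z \<Longrightarrow> f z = x i z" for f i l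
  proof -
    have "turing_le (x i) f" using that(2) by (intro turing_le_finite_change[of l]) simp
    then have "i = k" if "turing_le f (x k)" for k
      using that antichain turing_le_trans by metis
    then show ?thesis using that(1) by (auto simp: avoid_def)
  qed
  \<comment> \<open>Finiteness of \<open>E\<close> supplies an \<open>x j\<close> in
    \<open>avoid E\<close>, so the search for a successful segment terminates.\<close>
  obtain j where j: "j \<notin> E" using \<open>finite E\<close> ex_new_if_finite infinite_UNIV_nat by blast
  have "\<exists>g\<in>tagged (map (\<lambda>E'. avoid (E' - E)) Es). computes r h g" if h: "h \<in> C" for h
  proof -
    let ?b = "\<lambda>n. bounded_eval (fun_join (bit_fun n) h) n p [0]"
    have "\<exists>n. ?b n \<noteq> 0"
    proof -
      have "x j \<in> avoid E" by (rule x_avoid[OF j]) simp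
      from p[OF this h] obtain y where "eval (fun_join (x j) h) p [0] y"
        by (auto simp: computes_def)
      then obtain l where
        l: "\<forall>f' b. (\<forall>z<l. f' z = fun_join (x j) h z) \<longrightarrow> l \<le> b \<longrightarrow> bounded_eval f' b p [0] = Suc y"
        using bounded_eval_complete by blast
      obtain n where n: "l \<le> n" "\<And>z. z < l \<Longrightarrow> bit_fun n z = x j z"
        using bit_fun_extends[of "x j" l] binary by blast
      have "\<forall>z<l. fun_join (bit_fun n) h z = fun_join (x j) h z"
        using n(2) by (auto simp: fun_join_def)
      with l n(1) have "?b n = Suc y" by blast
      then show ?thesis by (intro exI[of _ n]) simp
    qed
    then obtain n where n: "?b n \<noteq> 0" "\<And>m. m < n \<Longrightarrow> ?b m = 0"
      using exists_least_iff[of "\<lambda>n. ?b n \<noteq> 0"] by blast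
    then obtain k where k: "?b n = Suc k" by (cases "?b n") auto
    have test: "eval h (Cond B (Numeral 1) Zero) [m] (if ?b m = 0 then 1 else 0)" for m
      by (rule eval_Cond[OF B eval_Numeral eval.Zero refl])
    have "eval h (Mu (Cond B (Numeral 1) Zero)) [] n"
    proof (rule eval.Mu)
      show "eval h (Cond B (Numeral 1) Zero) [n] 0" using test[of n] n(1) by simp
      show "\<forall>m<n. \<exists>y>0. eval h (Cond B (Numeral 1) Zero) [m] y"
        using test n(2) by (metis zero_less_one)
    qed
    then have K: "eval h K [] k"
      unfolding K_def by (rule eval_Comp_Pred[OF eval_Comp1[OF _ B]]) (simp add: k)
    have r: "computes r h (fun_cons k h)"
      unfolding computes_def
    proof
      fix z
      show "eval h r [z] (fun_cons k h z)"
      proof (induction z)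
        case 0
        show ?case unfolding r_def using K by (auto simp: fun_cons_def intro: eval.Prec_0)
      next
        case (Suc z)
        then show ?case unfolding r_def
          by (rule eval.Prec_Suc) (auto simp: fun_cons_def intro!: eval_Comp_Oracle eval_Proj')
      qed
    qed
    have "eval (fun_join (bit_fun n) h) p [0] k"
      by (rule bounded_eval_sound[OF k])
    then obtain l where
      l: "\<forall>f'. (\<forall>z<l. f' z = fun_join (bit_fun n) h z) \<longrightarrow> eval f' p [0] k"
      using eval_finite_use by blast
    have out: "\<exists>g. k < length Es \<and> g \<in> avoid (Es ! k) \<and> turing_le g (fun_join (x i) h)"
      if i: "i \<notin> E" for i
    proof -
      \<comment> \<open>The prefix of length \<open>l\<close> preserves the computation that
        selected \<open>k\<close>, while the tail makes \<open>f\<close> Turing equivalent to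
        \<open>x i\<close>.\<close>
      define f where "f z = (if z < l then bit_fun n z else x i z)" for z
      have "f \<in> avoid E" by (rule x_avoid[OF i, of l]) (simp add: f_def)
      from p[OF this h] obtain k' g where g: "computes p (fun_join f h) (fun_cons k' g)"
        "k' < length Es" "g \<in> avoid (Es ! k')"
        by (auto simp: tagged_def)
      have "\<forall>z<l. fun_join f h z = fun_join (bit_fun n) h z"
        by (auto simp: fun_join_def f_def)
      with l have "eval (fun_join f h) p [0] k" by blast
      moreover have "eval (fun_join f h) p [0] k'"
        using g(1) unfolding computes_def fun_cons_def by (metis nat.case(1))
      ultimately have "k' = k" by (rule eval_deterministic[symmetric])
      have "turing_le f (x i)" by (rule turing_le_finite_change[of l]) (simp add: f_def)
      then have "turing_le (fun_join f h) (fun_join (x i) h)"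
        by (meson turing_le_fun_join turing_le_fun_join_least turing_le_trans)
      moreover have "turing_le g (fun_join f h)"
        using turing_le_fun_cons(2) turing_leI[OF g(1)] by (rule turing_le_trans)
      ultimately show ?thesis
        using g \<open>k' = k\<close> turing_le_trans by blast
    qed
    have "k < length Es" using out[OF j] by blast
    moreover have "h \<in> avoid (Es ! k - E)"
      unfolding avoid_def
    proof (intro CollectI ballI notI)
      fix i assume i: "i \<in> Es ! k - E" and "turing_le h (x i)"
      then have "turing_le (fun_join (x i) h) (x i)"
        by (simp add: turing_le_fun_join_least turing_le_refl)
      with out[of i] i show False
        unfolding avoid_def using turing_le_trans by blast
    qed
    ultimately have "fun_cons k h \<in> tagged (map (\<lambda>E'. avoid (E' - E)) Es)"
      unfolding tagged_def by (intro CollectI exI[of _ k] exI[of _ h]) simp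
    with r show ?thesis by blast
  qed
  then show ?thesis by (rule medvedev_leI)
qed

section \<open>The embedding\<close>

definition avoid_degree :: "nat set \<Rightarrow> medvedev" where
  "avoid_degree E = abs_medvedev (avoid E)"

lemma avoid_degree_mono: "E \<subseteq> E' \<Longrightarrow> avoid_degree E \<le> avoid_degree E'"
  unfolding avoid_degree_def less_eq_medvedev.abs_eq
  by (rule medvedev_leI[where p = Oracle])
    (auto simp: avoid_def computes_def intro: eval.Oracle)

lemma avoid_degree_empty: "avoid_degree {} = bot"
  by (simp add: avoid_degree_def avoid_def bot_medvedev.abs_eq)

text \<open>Since \<open>fun_join f g\<close> computes both parts, it lies in no lower cone that
  omits one of them. The converse inequality is monotonicity.\<close>

lemma avoid_degree_Un: "avoid_degree (E \<union> E') = sup (avoid_degree E) (avoid_degree E')"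
proof (rule antisym)
  show "sup (avoid_degree E) (avoid_degree E') \<le> avoid_degree (E \<union> E')"
    by (simp add: avoid_degree_mono)
  have "fun_join f g \<in> avoid (E \<union> E')" if "f \<in> avoid E" "g \<in> avoid E'" for f g
    using that turing_le_fun_join turing_le_trans unfolding avoid_def by blast
  then have "mass_join (avoid E) (avoid E') \<subseteq> avoid (E \<union> E')"
    by (auto simp: mass_join_def)
  then show "avoid_degree (E \<union> E') \<le> sup (avoid_degree E) (avoid_degree E')"
    unfolding avoid_degree_def less_eq_medvedev.abs_eq sup_medvedev.abs_eq
    by (intro medvedev_leI[where p = Oracle]) (auto simp: computes_def intro: eval.Oracle)
qed

lemma Inf_fin_abs_medvedev:
  assumes "Es \<noteq> []"
  shows "Inf_fin ((\<lambda>E. abs_medvedev (F E)) ` set Es) = abs_medvedev (tagged (map F Es))"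
proof (rule antisym)
  let ?I = "Inf_fin ((\<lambda>E. abs_medvedev (F E)) ` set Es)"
  have "z \<le> abs_medvedev (tagged (map F Es)) \<longleftrightarrow> (\<forall>E\<in>set Es. z \<le> abs_medvedev (F E))" for z
    by (induction z) (simp add: less_eq_medvedev.abs_eq medvedev_le_tagged_iff)
  then have *: "z \<le> abs_medvedev (tagged (map F Es)) \<longleftrightarrow> z \<le> ?I" for z
    using assms by (simp add: Inf_fin.bounded_iff)
  show "?I \<le> abs_medvedev (tagged (map F Es))" using * by blast
  show "abs_medvedev (tagged (map F Es)) \<le> ?I" using * by blast
qed

lemma Inf_fin_avoid_degree_diff:
  assumes "finite E" "finite W" "W \<noteq> {}"
    and le: "Inf_fin (avoid_degree ` W) \<le> sup (avoid_degree E) c"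
  shows "Inf_fin ((\<lambda>E'. avoid_degree (E' - E)) ` W) \<le> c"
proof -
  from \<open>finite W\<close> obtain Es where Es: "set Es = W" by (metis finite_list)
  with \<open>W \<noteq> {}\<close> have "Es \<noteq> []" by auto
  then show ?thesis
    using le \<open>finite E\<close> unfolding Es[symmetric] avoid_degree_def
    by (induction c)
      (simp add: Inf_fin_abs_medvedev less_eq_medvedev.abs_eq sup_medvedev.abs_eq
        medvedev_le_avoid_diff)
qed

section \<open>The embedding and its lattice laws\<close>

text \<open>Complements make larger \<open>I\<close> give smaller degrees and turn intersections
  into joins. The extra index \<open>{}\<close> contributes the top of the factor: it gives the
  right value at \<open>U = {}\<close> and keeps the meet nonempty.\<close>

definition embed :: "nat \<Rightarrow> nat set set \<Rightarrow> medvedev" where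
  "embed n U = Inf_fin ((\<lambda>I. avoid_degree ({..<n} - I)) ` insert {} U)"

lemma finite_B_carrier: "U \<in> B_carrier n \<Longrightarrow> finite U"
  unfolding B_carrier_def by (auto intro: finite_subset)

lemma B_carrier_down:
  "U \<in> B_carrier n \<Longrightarrow> I \<in> U \<Longrightarrow> y \<subseteq> I \<Longrightarrow> y \<noteq> {} \<Longrightarrow> y \<in> U"
  unfolding B_carrier_def by blast

lemma le_embed_iff:
  "finite U \<Longrightarrow> z \<le> embed n U \<longleftrightarrow> (\<forall>I\<in>insert {} U. z \<le> avoid_degree ({..<n} - I))"
  unfolding embed_def by (subst Inf_fin.bounded_iff) auto

lemma embed_le: "finite U \<Longrightarrow> I \<in> insert {} U \<Longrightarrow> embed n U \<le> avoid_degree ({..<n} - I)"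
  using le_embed_iff by blast

lemma embed_antimono:
  assumes "finite U" "V \<subseteq> U"
  shows "embed n U \<le> embed n V"
proof -
  have "finite V" using assms finite_subset by blast
  moreover have "\<forall>I\<in>insert {} V. embed n U \<le> avoid_degree ({..<n} - I)"
    using assms embed_le by blast
  ultimately show ?thesis by (simp only: le_embed_iff)
qed

lemma embed_Un: "finite U \<Longrightarrow> finite V \<Longrightarrow> embed n (U \<union> V) = inf (embed n U) (embed n V)"
  unfolding embed_def by (subst Inf_fin.union[symmetric]) (auto simp: image_Un)

text \<open>Distributivity expands the right side into joins of two terms. The terms at
  \<open>I\<close> and \<open>J\<close> join to the term at \<open>I \<inter> J\<close>, which by
  downward closure belongs to both systems unless it is the extra index \<open>{}\<close>.\<close>

lemma embed_Int:
  assumes "U \<in> B_carrier n" "V \<in> B_carrier n"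
  shows "embed n (U \<inter> V) = sup (embed n U) (embed n V)"
proof (rule antisym)
  have fin: "finite U" "finite V" using assms by (simp_all add: finite_B_carrier)
  show "sup (embed n U) (embed n V) \<le> embed n (U \<inter> V)"
    using fin by (simp add: embed_antimono)
  have "embed n (U \<inter> V) \<le> sup (avoid_degree ({..<n} - I)) (avoid_degree ({..<n} - J))"
    if "I \<in> insert {} U" "J \<in> insert {} V" for I J
  proof -
    have "I \<inter> J \<in> insert {} (U \<inter> V)"
    proof (cases "I \<inter> J = {}")
      case False
      then have "I \<in> U" "J \<in> V" using that by auto
      then show ?thesis
        using False B_carrier_down[OF assms(1), of I] B_carrier_down[OF assms(2), of J] by simp
    qed simp
    then have "embed n (U \<inter> V) \<le> avoid_degree ({..<n} - (I \<inter> J))"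
      using fin by (intro embed_le) auto
    then show ?thesis by (simp add: Diff_Int avoid_degree_Un)
  qed
  note * = this
  have "embed n (U \<inter> V) \<le>
      Inf_fin {sup a b | a b. a \<in> (\<lambda>I. avoid_degree ({..<n} - I)) ` insert {} U \<and>
        b \<in> (\<lambda>I. avoid_degree ({..<n} - I)) ` insert {} V}" (is "_ \<le> Inf_fin ?S")
  proof (rule Inf_fin.boundedI)
    show "finite ?S" using fin by (intro finite_image_set2) auto
    show "?S \<noteq> {}" by blast
    show "embed n (U \<inter> V) \<le> a" if "a \<in> ?S" for a
      using that * by (elim CollectE exE conjE imageE) (simp only:)
  qed
  then show "embed n (U \<inter> V) \<le> sup (embed n U) (embed n V)"
    using fin unfolding embed_def by (subst sup_Inf2_distrib) auto
qed

section \<open>Residuals and reflection of the order\<close>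

text \<open>For \<open>I \<subseteq> {..<n}\<close>, \<open>?W\<close> is the implication from the
  system of nonempty subsets of \<open>I\<close> to \<open>V\<close>. Each of its members lies in
  some \<open>J \<union> ({..<n} - I)\<close>, and the complements of these sets are the differences
  produced by \<open>Inf_fin_avoid_degree_diff\<close>.\<close>

lemma embed_residual:
  assumes "V \<in> B_carrier n" and le: "embed n V \<le> sup (avoid_degree ({..<n} - I)) c"
  shows "embed n {y \<in> Pow {..<n} - {{}}. \<exists>J\<in>insert {} V. y \<inter> I \<subseteq> J} \<le> c"
    (is "embed n ?W \<le> c")
proof -
  have fin: "finite V" using assms by (simp add: finite_B_carrier)
  have *: "embed n ?W \<le> avoid_degree ({..<n} - J - ({..<n} - I))" if "J \<in> insert {} V" for J
  proof -
    have "(J \<union> - I) \<inter> {..<n} \<in> insert {} ?W" using that by blast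
    then have "embed n ?W \<le> avoid_degree ({..<n} - (J \<union> - I) \<inter> {..<n})"
      by (intro embed_le) auto
    moreover have "{..<n} - (J \<union> - I) \<inter> {..<n} = {..<n} - J - ({..<n} - I)" by blast
    ultimately show ?thesis by simp
  qed
  have "embed n ?W \<le>
      Inf_fin ((\<lambda>E'. avoid_degree (E' - ({..<n} - I))) ` (\<lambda>J. {..<n} - J) ` insert {} V)"
  proof (rule Inf_fin.boundedI)
    fix a assume "a \<in> (\<lambda>E'. avoid_degree (E' - ({..<n} - I))) ` (\<lambda>J. {..<n} - J) ` insert {} V"
    then show "embed n ?W \<le> a" using * by (elim imageE) (simp only:)
  qed (use fin in auto)
  also have "\<dots> \<le> c"
    using le fin by (intro Inf_fin_avoid_degree_diff) (auto simp: embed_def image_image)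
  finally show ?thesis .
qed

text \<open>If the meet is \<open>bot\<close>, one of its components contains a computable function.
  Such a function lies in every lower cone, so that component avoids no cone and its index is all of
  \<open>{..<n}\<close>.\<close>

lemma embed_eq_bot_iff:
  assumes "U \<in> B_carrier n" "n \<ge> 1"
  shows "embed n U = bot \<longleftrightarrow> {..<n} \<in> U"
proof
  assume "{..<n} \<in> U"
  then have "embed n U \<le> avoid_degree ({..<n} - {..<n})"
    using finite_B_carrier[OF assms(1)] by (intro embed_le) auto
  then show "embed n U = bot" by (simp add: avoid_degree_empty bot_unique)
next
  assume bot: "embed n U = bot"
  obtain Is where Is: "set Is = insert {} U"
    using finite_B_carrier[OF assms(1)] by (metis finite_list finite.insertI)
  then have "Is \<noteq> []" by auto
  have "abs_medvedev (tagged (map (\<lambda>I. avoid ({..<n} - I)) Is)) = bot"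
    using bot Inf_fin_abs_medvedev[OF \<open>Is \<noteq> []\<close>, of "\<lambda>I. avoid ({..<n} - I)"]
    by (simp add: embed_def Is avoid_degree_def)
  then have "medvedev_le (tagged (map (\<lambda>I. avoid ({..<n} - I)) Is)) UNIV"
    by (simp add: bot_medvedev.abs_eq less_eq_medvedev.abs_eq[symmetric])
  then obtain p g where "g \<in> tagged (map (\<lambda>I. avoid ({..<n} - I)) Is)" "computes p (\<lambda>_. 0) g"
    unfolding medvedev_le_def by blast
  moreover from this have "turing_le g (\<lambda>_. 0)" by (simp add: turing_leI)
  ultimately obtain k f where kf: "k < length Is" "f \<in> avoid ({..<n} - Is ! k)" "turing_le (fun_cons k f) (\<lambda>_. 0)"
    by (auto simp: tagged_def)
  have "turing_le (\<lambda>_. 0) h" for h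
    by (rule turing_leI[of Zero]) (auto simp: computes_def intro: eval.Zero)
  then have "turing_le f h" for h
    using kf(3) turing_le_fun_cons(2) turing_le_trans by metis
  then have "{..<n} \<subseteq> Is ! k" using kf(2) by (auto simp: avoid_def)
  moreover have "Is ! k \<in> insert {} U" using kf(1) Is nth_mem by blast
  \<comment> \<open>This rules out the extra index \<open>{}\<close>.\<close>
  moreover have "{..<n} \<noteq> {}" using assms(2) by (simp add: lessThan_empty_iff)
  ultimately show "{..<n} \<in> U"
    using assms(1) unfolding B_carrier_def by blast
qed

text \<open>This yields injectivity. For \<open>I \<in> V\<close>, taking the residual at
  \<open>I\<close> with \<open>c = bot\<close> reduces the claim to the characterization of
  \<open>bot\<close>: \<open>{..<n} \<in> ?W\<close> says that \<open>I\<close> lies in some member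
  of \<open>U\<close>.\<close>

lemma embed_le_imp_superset:
  assumes "U \<in> B_carrier n" "V \<in> B_carrier n" "n \<ge> 1" "embed n U \<le> embed n V"
  shows "V \<subseteq> U"
proof
  fix I assume I: "I \<in> V"
  let ?W = "{y \<in> Pow {..<n} - {{}}. \<exists>J\<in>insert {} U. y \<inter> I \<subseteq> J}"
  have "embed n V \<le> avoid_degree ({..<n} - I)"
    using I assms(2) by (simp add: embed_le finite_B_carrier)
  with assms(4) have "embed n U \<le> sup (avoid_degree ({..<n} - I)) bot" by simp
  then have "embed n ?W \<le> bot" by (rule embed_residual[OF assms(1)])
  moreover have "?W \<in> B_carrier n" unfolding B_carrier_def by blast
  ultimately have "{..<n} \<in> ?W"
    using embed_eq_bot_iff[of ?W n] assms(3) by (simp only: bot_unique)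
  moreover have "I \<subseteq> {..<n}" "I \<noteq> {}" using I assms(2) by (auto simp: B_carrier_def)
  ultimately obtain J where "J \<in> U" "I \<subseteq> J" by auto
  then show "I \<in> U" using \<open>I \<noteq> {}\<close> B_carrier_down[OF assms(1)] by blast
qed

section \<open>Preservation of implication\<close>

lemma is_min_imp_embed:
  assumes U: "U \<in> B_carrier n" and V: "V \<in> B_carrier n" and "n \<ge> 1"
  shows "is_min_imp UNIV (\<le>) sup (embed n U) (embed n V) (embed n (imp (B_algebra n) U V))"
proof -
  define R where "R = imp (B_algebra n) U V"
  have R_eq: "R = {y \<in> Pow {..<n} - {{}}. \<forall>z. z \<subseteq> y \<and> z \<noteq> {} \<and> z \<in> U \<longrightarrow> z \<in> V}"
    unfolding R_def by (rule imp_B_algebra[OF U V])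
  have R: "R \<in> B_carrier n" "U \<inter> R \<subseteq> V"
    using is_min_imp_B_algebra[OF U V] by (simp_all add: R_eq is_min_imp_def)
  have fin: "finite U" "finite V" "finite R" using U V R by (simp_all add: finite_B_carrier)
  have "embed n V \<le> sup (embed n U) (embed n R)"
    using R(2) fin by (simp add: embed_Int[OF U R(1), symmetric] embed_antimono)
  moreover have "embed n R \<le> c" if c: "embed n V \<le> sup (embed n U) c" for c
  proof -
    \<comment> \<open>The simultaneous residual for all \<open>I \<in> F\<close>. Each single
      residual is below \<open>c\<close> because \<open>embed n U\<close> lies below its term at
      \<open>I\<close>, and intersecting residuals amounts to joining their degrees.\<close>
    define W where "W F = {y \<in> Pow {..<n} - {{}}. \<forall>I\<in>F. \<exists>J\<in>insert {} V. y \<inter> I \<subseteq> J}" for F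
    have W: "W F \<in> B_carrier n" for F
      unfolding B_carrier_def
    proof (intro CollectI conjI ballI allI impI)
      fix z y assume z: "z \<in> W F" and y: "y \<subseteq> z \<and> y \<noteq> {}"
      have "\<exists>J\<in>insert {} V. y \<inter> I \<subseteq> J" if "I \<in> F" for I
      proof -
        have "\<exists>J\<in>insert {} V. z \<inter> I \<subseteq> J" using z that by (simp add: W_def)
        then obtain J where "J \<in> insert {} V" "z \<inter> I \<subseteq> J" by (rule bexE)
        then show ?thesis using y by (intro bexI[of _ J]) auto
      qed
      moreover have "y \<in> Pow {..<n} - {{}}" using z y unfolding W_def by blast
      ultimately show "y \<in> W F" by (simp add: W_def)
    qed (auto simp: W_def)
    have "embed n (W F) \<le> c" if "finite F" "F \<subseteq> U" for F
      using that
    proof (induction F)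
      case empty
      have "{..<n} \<in> W {}" using \<open>n \<ge> 1\<close> by (simp add: W_def lessThan_empty_iff)
      then have "embed n (W {}) = bot" using embed_eq_bot_iff[OF W \<open>n \<ge> 1\<close>] by blast
      then show ?case by simp
    next
      case (insert I F)
      have "embed n V \<le> sup (embed n U) c" by (rule c)
      also have "\<dots> \<le> sup (avoid_degree ({..<n} - I)) c"
        using insert.prems fin by (intro sup_mono embed_le) auto
      finally have "embed n (W {I}) \<le> c"
        using embed_residual[OF V, of I c] by (simp add: W_def)
      moreover have "embed n (W F) \<le> c" using insert by simp
      moreover have "W (insert I F) = W {I} \<inter> W F" by (auto simp: W_def)
      ultimately show ?case by (simp add: embed_Int W)
    qed
    then have "embed n (W U) \<le> c" using fin by blast
    \<comment> \<open>As \<open>embed\<close> reverses inclusion, this inclusion suffices for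
      \<open>embed n R \<le> c\<close>.\<close>
    moreover have "W U \<subseteq> R"
    proof
      fix y assume y: "y \<in> W U"
      have "z \<in> V" if z: "z \<subseteq> y" "z \<noteq> {}" "z \<in> U" for z
      proof -
        have "\<exists>J\<in>insert {} V. y \<inter> z \<subseteq> J" using y z(3) by (simp add: W_def)
        then obtain J where "J \<in> insert {} V" "y \<inter> z \<subseteq> J" by (rule bexE)
        then have "J \<in> V" "z \<subseteq> J" using z by auto
        then show ?thesis using B_carrier_down[OF V] z(2) by blast
      qed
      then show "y \<in> R" using y by (auto simp: W_def R_eq)
    qed
    ultimately show ?thesis using embed_antimono[OF fin(3)] order_trans by blast
  qed
  ultimately show ?thesis by (simp add: is_min_imp_def R_def)
qed

text \<open>The factor keeps the implication of the whole Medvedev lattice, hence the minimality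
  over \<open>UNIV\<close>. The degree of the factor is the image of \<open>{}\<close>, the top of
  the finite algebra.\<close>

lemma B_embedding_embed:
  assumes "n \<ge> 1"
  shows "B_embedding (embed n) (B_algebra n) (factor medvedev_algebra (embed n {}))"
proof -
  have "Pow {..<n} - {{}} \<in> B_carrier n" by (auto simp: B_carrier_def)
  moreover have "{..<n} \<in> Pow {..<n} - {{}}" using assms by (simp add: lessThan_empty_iff)
  ultimately have "embed n (Pow {..<n} - {{}}) = bot"
    using embed_eq_bot_iff assms by blast
  moreover have "min_imp UNIV (\<le>) sup (embed n U) (embed n V) = embed n (imp (B_algebra n) U V)"
    if "U \<in> B_carrier n" "V \<in> B_carrier n" for U V
    using is_min_imp_embed[OF that assms] by (rule min_imp_eqI) simp
  moreover have "inj_on (embed n) (B_carrier n)"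
    by (rule inj_onI) (use assms embed_le_imp_superset in \<open>metis order_refl subset_antisym\<close>)
  ultimately show ?thesis
    by (auto simp: B_embedding_def factor_def medvedev_algebra_def B_algebra_def embed_Int embed_Un
        finite_B_carrier embed_antimono)
qed

end

theorem theorem5p1:
  fixes n :: nat
  assumes "n \<ge> 1"
  shows "\<exists>D :: medvedev. B_embeddable (B_algebra n) (factor medvedev_algebra D)"
proof -
  obtain x where "turing_antichain x"
    using infinite_turing_antichain by (metis turing_antichain.intro)
  then interpret turing_antichain x .
  show ?thesis
    using B_embedding_embed[OF assms] unfolding B_embeddable_def by blast
qed

end
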